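(* Let $k,n>1$ be integers. The lattices $G_1,G_2,G_3,G_4<\operatorname{Aut}(X_{k,kn})$ described in the context (with $G_3$ and $G_4$ included only when their defining conditions on $k,n$ hold) admit isomorphic Cayley graphs; that is, any two of them admit isomorphic Cayley graphs.
   Context: Cayley graphs. For a finitely generated group $G$ and a finite symmetric generating set $S\not\ni1$, $\operatorname{Cay}(G,S)$ is the graph with vertex set $G$ and, for each $g\in G$, $s\in S$, a unique edge from $g$ to $gs$ (labeled $s$; its reverse is labeled $s^{-1}$). Groups $G,G'$ admit isomorphic Cayley graphs if there are such generating sets $S,S'$ with $\operatorname{Cay}(G,S)$ and $\operatorname{Cay}(G',S')$ isomorphic as unlabeled graphs. Labeled graphs. A labeled graph is a connected graph in which each edge carries a non-zero integer at each of its two ends. It defines a graph of groups with all vertex and edge groups $\mathbb{Z}$, where the inclusion of an edge group into the vertex group at one of its ends is multiplication by the label at that end. The group defined by a labeled graph is the fundamental group of this graph of groups. The groups. Each is defined by a labeled graph with exactly two vertices $v$ and $u$, all edges joining $v$ to $u$; an edge with labels $(x,y)$ has label $x$ at $v$ and $y$ at $u$. - $G_1$: two edges, with labels $(k,kn)$ and $(kn,k)$. (It is the index-2 subgroup $\langle a,tat^{-1},t^2\rangle$ of $BS(k,kn)=\langle a,t\mid ta^kt^{-1}=a^{kn}\rangle$.) - $G_2$: one edge with labels $(k,kn)$ and $k$ edges with labels $(n,1)$. - $G_3$ (defined when $p$ is a divisor of $n$ with $1<p<k$): $k$ edges with labels $(n,1)$, $k-p$ edges with labels $(1,n)$, and one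 edge with labels $(p,pn)$. - $G_4$ (defined when $n<k$ and $k\equiv1\bmod n$): $k$ edges with labels $(n,1)$, one edge with labels $(1,n)$, and $(k-1)/n$ edges with labels $(n,n^2)$. Each $G_i$ acts freely and cocompactly by combinatorial automorphisms on the universal cover of its associated graph of circles and annuli, and with a suitable cell structure this universal cover is isomorphic to $X_{k,kn}$ (defined below), making $G_i$ a uniform lattice in $\operatorname{Aut}(X_{k,kn})$. The complex $X_{k,kn}$: the universal cover, with induced cell structure, of the 2-complex with one vertex, 1-cells $a,t_0,\dots,t_{k-1}$, and $k$ 2-cells attached along $t_iat_{i+1}^{-1}a^{-n}$ (indices modulo $k$). $\operatorname{Aut}(X_{k,kn})$ is the group of cell-structure-preserving homeomorphisms modulo those inducing the identity on the set of cells, topologized by the subbasis $\{f\mid f(\sigma)=\tau\}$, $\sigma,\tau$ cells. *)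

theory Defs
  imports
    "Graph_Theory.Graph_Theory"
    "HOL-Algebra.Elementary_Groups"
    "HOL-Number_Theory.Cong"
begin

section \<open>Groups given by generators and relations\<close>

text \<open>
  A letter \<^term>\<open>(x, True)\<close> stands for the generator \<^term>\<open>x\<close>, and \<^term>\<open>(x, False)\<close> for its
  inverse. A relation is a pair of words that become equal in the group.
\<close>

type_synonym 'x word = "('x \<times> bool) list"

abbreviation words :: "'x set \<Rightarrow> 'x word set" where
  "words X \<equiv> lists (X \<times> UNIV)"

inductive word_eq :: "'x set \<Rightarrow> ('x word \<times> 'x word) set \<Rightarrow> 'x word \<Rightarrow> 'x word \<Rightarrow> bool"
  for X :: "'x set" and R :: "('x word \<times> 'x word) set" where
  refl: "w \<in> words X \<Longrightarrow> word_eq X R w w"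
| sym: "word_eq X R w w' \<Longrightarrow> word_eq X R w' w"
| trans: "word_eq X R w w' \<Longrightarrow> word_eq X R w' w'' \<Longrightarrow> word_eq X R w w''"
| cancel: "p \<in> words X \<Longrightarrow> q \<in> words X \<Longrightarrow> x \<in> X \<Longrightarrow>
    word_eq X R (p @ [(x, b), (x, \<not> b)] @ q) (p @ q)"
| relation: "p \<in> words X \<Longrightarrow> q \<in> words X \<Longrightarrow> (l, r) \<in> R \<Longrightarrow> l \<in> words X \<Longrightarrow> r \<in> words X \<Longrightarrow>
    word_eq X R (p @ l @ q) (p @ r @ q)"

definition word_rel :: "'x set \<Rightarrow> ('x word \<times> 'x word) set \<Rightarrow> ('x word \<times> 'x word) set" where
  "word_rel X R = {(w, w'). word_eq X R w w'}"

definition presented_group ::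
    "'x set \<Rightarrow> ('x word \<times> 'x word) set \<Rightarrow> 'x word set monoid" where
  "presented_group X R =
    \<lparr>carrier = words X // word_rel X R,
     monoid.mult = (\<lambda>A B. \<Union>w\<in>A. \<Union>w'\<in>B. word_rel X R `` {w @ w'}),
     one = word_rel X R `` {[]}\<rparr>"

lemma word_eq_words:
  "word_eq X R w w' \<Longrightarrow> w \<in> words X \<and> w' \<in> words X"
  by (induction rule: word_eq.induct) auto

lemma equiv_word_rel: "equiv (words X) (word_rel X R)"
proof (rule equivI)
  show "word_rel X R \<subseteq> words X \<times> words X"
    using word_eq_words by (fastforce simp: word_rel_def)
  show "refl_on (words X) (word_rel X R)"
    by (auto simp: refl_on_def word_rel_def intro: word_eq.refl)
  show "Relation.sym (word_rel X R)"
    by (auto simp: sym_def word_rel_def intro: word_eq.sym)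
  show "Relation.trans (word_rel X R)"
    by (auto simp: trans_def word_rel_def intro: word_eq.trans)
qed

lemma word_eq_append_context:
  "word_eq X R w w' \<Longrightarrow> p \<in> words X \<Longrightarrow> q \<in> words X \<Longrightarrow> word_eq X R (p @ w @ q) (p @ w' @ q)"
proof (induction rule: word_eq.induct)
  case (refl w)
  then show ?case by (intro word_eq.refl) auto
next
  case (cancel p' q' x b)
  then show ?case
    using word_eq.cancel[of "p @ p'" X "q' @ q" x R b] by auto
next
  case (relation p' q' l r)
  then show ?case
    using word_eq.relation[of "p @ p'" X "q' @ q" l r R] by auto
qed (blast intro: word_eq.sym word_eq.trans)+

lemma word_eq_append:
  assumes "word_eq X R v v'" "word_eq X R w w'"
  shows "word_eq X R (v @ w) (v' @ w')"
proof -
  have "word_eq X R (v @ w) (v' @ w)"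
    using word_eq_append_context[OF assms(1), of "[]" w] word_eq_words[OF assms(2)] by auto
  moreover have "word_eq X R (v' @ w) (v' @ w')"
    using word_eq_append_context[OF assms(2), of v' "[]"] word_eq_words[OF assms(1)] by auto
  ultimately show ?thesis by (rule word_eq.trans)
qed

lemma mult_presented_group:
  assumes "v \<in> words X" "w \<in> words X"
  shows "(word_rel X R `` {v}) \<otimes>\<^bsub>presented_group X R\<^esub> (word_rel X R `` {w}) =
    word_rel X R `` {v @ w}"
proof -
  have "congruent2 (word_rel X R) (word_rel X R) (\<lambda>v w. word_rel X R `` {v @ w})"
  proof (rule congruent2I'[OF equiv_class_eq[OF equiv_word_rel]])
    fix v v' w w' assume "(v, v') \<in> word_rel X R" "(w, w') \<in> word_rel X R"
    then show "(v @ w, v' @ w') \<in> word_rel X R"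
      by (simp add: word_rel_def word_eq_append)
  qed
  from UN_equiv_class2[OF equiv_word_rel equiv_word_rel this assms]
  show ?thesis by (simp add: presented_group_def)
qed

lemma word_inverse:
  "w \<in> words X \<Longrightarrow> word_eq X R (rev (map (\<lambda>(x, b). (x, \<not> b)) w) @ w) []"
proof (induction w)
  case Nil
  then show ?case by (auto intro: word_eq.refl)
next
  case (Cons a w)
  obtain x b where a: "a = (x, b)" by force
  let ?i = "rev (map (\<lambda>(x, b). (x, \<not> b)) w)"
  have "?i \<in> words X" "w \<in> words X" "x \<in> X"
    using Cons.prems a by (auto simp: in_lists_conv_set split: prod.splits)
  then have "word_eq X R (?i @ [(x, \<not> b), (x, \<not> \<not> b)] @ w) (?i @ w)"
    by (rule word_eq.cancel)
  then show ?case using Cons a by (auto intro: word_eq.trans)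
qed

lemma group_presented_group: "group (presented_group X R)"
proof (rule groupI)
  let ?P = "presented_group X R" and ?c = "\<lambda>w. word_rel X R `` {w}"
  have car: "A \<in> carrier ?P \<longleftrightarrow> (\<exists>w \<in> words X. A = ?c w)" for A
    by (auto simp: presented_group_def quotient_def)
  have one: "\<one>\<^bsub>?P\<^esub> = ?c []" by (simp add: presented_group_def)
  show "\<one>\<^bsub>?P\<^esub> \<in> carrier ?P" unfolding car one by blast
  show "A \<otimes>\<^bsub>?P\<^esub> B \<in> carrier ?P" if "A \<in> carrier ?P" "B \<in> carrier ?P" for A B
  proof -
    from that obtain v w where "v \<in> words X" "w \<in> words X" "A = ?c v" "B = ?c w"
      by (auto simp: car)
    then show ?thesis unfolding car
      by (intro bexI[of _ "v @ w"]) (auto simp: mult_presented_group)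
  qed
  show "A \<otimes>\<^bsub>?P\<^esub> B \<otimes>\<^bsub>?P\<^esub> C = A \<otimes>\<^bsub>?P\<^esub> (B \<otimes>\<^bsub>?P\<^esub> C)"
    if "A \<in> carrier ?P" "B \<in> carrier ?P" "C \<in> carrier ?P" for A B C
  proof -
    from that obtain u v w where "u \<in> words X" "v \<in> words X" "w \<in> words X"
      "A = ?c u" "B = ?c v" "C = ?c w"
      by (auto simp: car)
    then show ?thesis
      using mult_presented_group[of "u @ v" X w R] mult_presented_group[of u X "v @ w" R]
      by (simp add: mult_presented_group)
  qed
  show "\<one>\<^bsub>?P\<^esub> \<otimes>\<^bsub>?P\<^esub> A = A" if "A \<in> carrier ?P" for A
  proof -
    from that obtain w where "w \<in> words X" "A = ?c w" by (auto simp: car)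
    then show ?thesis using mult_presented_group[of "[]" X w R] by (simp add: one)
  qed
  show "\<exists>B\<in>carrier ?P. B \<otimes>\<^bsub>?P\<^esub> A = \<one>\<^bsub>?P\<^esub>" if "A \<in> carrier ?P" for A
  proof -
    from that obtain w where w: "w \<in> words X" "A = ?c w" by (auto simp: car)
    let ?i = "rev (map (\<lambda>(x, b). (x, \<not> b)) w)"
    have i: "?i \<in> words X" using w(1) by (auto simp: in_lists_conv_set split: prod.splits)
    have "?c (?i @ w) = ?c []"
      using word_inverse[OF w(1)]
      by (intro equiv_class_eq[OF equiv_word_rel]) (simp add: word_rel_def)
    then have "?c ?i \<otimes>\<^bsub>?P\<^esub> A = \<one>\<^bsub>?P\<^esub>"
      using mult_presented_group[OF i w(1)] by (simp add: w(2) one)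
    moreover have "?c ?i \<in> carrier ?P" unfolding car using i by blast
    ultimately show ?thesis by blast
  qed
qed


section \<open>Graphs of groups and labeled graphs\<close>

text \<open>
  The underlying graph is a directed multigraph: each unoriented edge is represented by one arc,
  with an arbitrarily chosen orientation. The two inclusions of the edge group go to the vertex
  groups at the tail and at the head of that arc.
\<close>

record ('v, 'e, 'g, 'h) graph_of_groups =
  underlying :: "('v, 'e) pre_digraph"
  vertex_group :: "'v \<Rightarrow> 'g monoid"
  edge_group :: "'e \<Rightarrow> 'h monoid"
  tail_incl :: "'e \<Rightarrow> 'h \<Rightarrow> 'g"
  head_incl :: "'e \<Rightarrow> 'h \<Rightarrow> 'g"

definition is_graph_of_groups :: "('v, 'e, 'g, 'h) graph_of_groups \<Rightarrow> bool" where
  "is_graph_of_groups \<G> \<longleftrightarrow>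
    wf_digraph (underlying \<G>) \<and> Digraph_Component.connected (underlying \<G>) \<and>
    (\<forall>v \<in> verts (underlying \<G>). group (vertex_group \<G> v)) \<and>
    (\<forall>e \<in> arcs (underlying \<G>).
      group (edge_group \<G> e) \<and>
      tail_incl \<G> e \<in> mon (edge_group \<G> e) (vertex_group \<G> (tail (underlying \<G>) e)) \<and>
      head_incl \<G> e \<in> mon (edge_group \<G> e) (vertex_group \<G> (head (underlying \<G>) e)))"

text \<open>
  Maximal trees as minimal connected spanning subgraphs. The constant \<^const>\<open>forest\<close> of the
  library excludes only directed cycles, so \<^const>\<open>spanning_tree\<close> is not the right notion for a
  graph with one arc per edge.
\<close>

definition maximal_tree :: "'e set \<Rightarrow> ('v, 'e) pre_digraph \<Rightarrow> bool" where
  "maximal_tree T \<Gamma> \<longleftrightarrow>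
    T \<subseteq> arcs \<Gamma> \<and> Digraph_Component.connected (\<Gamma>\<lparr>arcs := T\<rparr>) \<and>
    (\<forall>T'. T' \<subset> T \<longrightarrow> \<not> Digraph_Component.connected (\<Gamma>\<lparr>arcs := T'\<rparr>))"

text \<open>
  Fundamental group relative to a maximal tree \<open>T\<close>, as in Serre's ``Trees'': it is generated by
  the vertex groups and a stable letter for every edge, where conjugation by the stable letter
  of \<open>e\<close> carries the head inclusion of the edge group to the tail inclusion, and the stable letters
  of \<open>T\<close> are trivial. Up to isomorphism it depends neither on \<open>T\<close> nor on the orientation.
\<close>

datatype ('v, 'e, 'g) gog_gen = Vertex_elem 'v 'g | Stable_letter 'e

definition pi1_gens :: "('v, 'e, 'g, 'h) graph_of_groups \<Rightarrow> ('v, 'e, 'g) gog_gen set" where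
  "pi1_gens \<G> =
    {Vertex_elem v g | v g. v \<in> verts (underlying \<G>) \<and> g \<in> carrier (vertex_group \<G> v)} \<union>
    {Stable_letter e | e. e \<in> arcs (underlying \<G>)}"

definition pi1_rels ::
    "('v, 'e, 'g, 'h) graph_of_groups \<Rightarrow> 'e set \<Rightarrow>
     (('v, 'e, 'g) gog_gen word \<times> ('v, 'e, 'g) gog_gen word) set" where
  "pi1_rels \<G> T =
    {([(Vertex_elem v g, True), (Vertex_elem v h, True)],
      [(Vertex_elem v (g \<otimes>\<^bsub>vertex_group \<G> v\<^esub> h), True)]) | v g h.
      v \<in> verts (underlying \<G>) \<and>
      g \<in> carrier (vertex_group \<G> v) \<and> h \<in> carrier (vertex_group \<G> v)} \<union>
    {([(Stable_letter e, True),
       (Vertex_elem (head (underlying \<G>) e) (head_incl \<G> e c), True),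
       (Stable_letter e, False)],
      [(Vertex_elem (tail (underlying \<G>) e) (tail_incl \<G> e c), True)]) | e c.
      e \<in> arcs (underlying \<G>) \<and> c \<in> carrier (edge_group \<G> e)} \<union>
    {([(Stable_letter e, True)], []) | e. e \<in> T}"

definition pi1 ::
    "('v, 'e, 'g, 'h) graph_of_groups \<Rightarrow> 'e set \<Rightarrow> ('v, 'e, 'g) gog_gen word set monoid" where
  "pi1 \<G> T = presented_group (pi1_gens \<G>) (pi1_rels \<G> T)"

record ('v, 'e) labeled_graph =
  lgraph :: "('v, 'e) pre_digraph"
  tail_label :: "'e \<Rightarrow> int"
  head_label :: "'e \<Rightarrow> int"

definition is_labeled_graph :: "('v, 'e) labeled_graph \<Rightarrow> bool" where
  "is_labeled_graph L \<longleftrightarrow>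
    wf_digraph (lgraph L) \<and> Digraph_Component.connected (lgraph L) \<and>
    (\<forall>e \<in> arcs (lgraph L). tail_label L e \<noteq> 0 \<and> head_label L e \<noteq> 0)"

definition gog_of_labeled_graph ::
    "('v, 'e) labeled_graph \<Rightarrow> ('v, 'e, int, int) graph_of_groups" where
  "gog_of_labeled_graph L =
    \<lparr>underlying = lgraph L,
     vertex_group = (\<lambda>_. integer_group),
     edge_group = (\<lambda>_. integer_group),
     tail_incl = (\<lambda>e c. tail_label L e * c),
     head_incl = (\<lambda>e c. head_label L e * c)\<rparr>"

lemma is_graph_of_groups_gog_of_labeled_graph:
  "is_labeled_graph L \<Longrightarrow> is_graph_of_groups (gog_of_labeled_graph L)"
  by (auto simp: is_labeled_graph_def is_graph_of_groups_def gog_of_labeled_graph_def mon_def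
      hom_def inj_on_def integer_group_def algebra_simps group_integer_group[unfolded integer_group_def])

definition labeled_graph_group ::
    "('v, 'e) labeled_graph \<Rightarrow> 'e set \<Rightarrow> ('v, 'e, int) gog_gen word set monoid" where
  "labeled_graph_group L T = pi1 (gog_of_labeled_graph L) T"


section \<open>Cayley graphs\<close>

definition cayley_gen_set :: "('a, 'b) monoid_scheme \<Rightarrow> 'a set \<Rightarrow> bool" where
  "cayley_gen_set G S \<longleftrightarrow>
    finite S \<and> S \<subseteq> carrier G \<and> (\<forall>s\<in>S. inv\<^bsub>G\<^esub> s \<in> S) \<and> \<one>\<^bsub>G\<^esub> \<notin> S \<and>
    generate G S = carrier G"

text \<open>
  The arc \<open>(g, s)\<close> is the edge from \<open>g\<close> to \<open>gs\<close> traversed in the direction labeled \<open>s\<close>; the same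
  edge traversed backwards is the arc \<open>(gs, s\<^sup>-\<^sup>1)\<close>. As \<open>S\<close> is symmetric and does not contain \<open>1\<close>,
  this digraph is symmetric without loops or parallel arcs, so that its isomorphisms as a
  digraph are exactly the isomorphisms of the unlabeled undirected Cayley graphs.
\<close>

definition Cay :: "('a, 'b) monoid_scheme \<Rightarrow> 'a set \<Rightarrow> ('a, 'a \<times> 'a) pre_digraph" where
  "Cay G S =
    \<lparr>verts = carrier G, arcs = carrier G \<times> S, tail = fst, head = (\<lambda>(g, s). g \<otimes>\<^bsub>G\<^esub> s)\<rparr>"

definition admit_isomorphic_Cayley_graphs ::
    "('a, 'c) monoid_scheme \<Rightarrow> ('b, 'd) monoid_scheme \<Rightarrow> bool" where
  "admit_isomorphic_Cayley_graphs G H \<longleftrightarrow>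
    (\<exists>S S'. cayley_gen_set G S \<and> cayley_gen_set H S' \<and> digraph_iso (Cay G S) (Cay H S'))"


section \<open>The lattices\<close>

datatype two_vertices = vertex_v | vertex_u

text \<open>
  All edges join \<open>v\<close> to \<open>u\<close>, one for each entry \<open>(x, y)\<close> of the list, with label \<open>x\<close> at \<open>v\<close> and
  label \<open>y\<close> at \<open>u\<close>. Any single edge is a maximal tree; we take the first one.
\<close>

definition two_vertex_graph :: "(int \<times> int) list \<Rightarrow> (two_vertices, nat) labeled_graph" where
  "two_vertex_graph ls =
    \<lparr>lgraph = \<lparr>verts = {vertex_v, vertex_u}, arcs = {..<length ls},
               tail = (\<lambda>_. vertex_v), head = (\<lambda>_. vertex_u)\<rparr>,
     tail_label = (\<lambda>i. fst (ls ! i)),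
     head_label = (\<lambda>i. snd (ls ! i))\<rparr>"

definition two_vertex_group ::
    "(int \<times> int) list \<Rightarrow> (two_vertices, nat, int) gog_gen word set monoid" where
  "two_vertex_group ls = labeled_graph_group (two_vertex_graph ls) {0}"

lemma connected_two_vertex_graph:
  "Digraph_Component.connected ((lgraph (two_vertex_graph ls))\<lparr>arcs := T\<rparr>) \<longleftrightarrow> T \<noteq> {}"
proof -
  let ?G = "(lgraph (two_vertex_graph ls))\<lparr>arcs := T\<rparr>"
  let ?V = "{vertex_v, vertex_u}"
  let ?P = "if T = {} then {} else {(vertex_v, vertex_u), (vertex_u, vertex_v)}"
  have G: "mk_symmetric ?G = \<lparr>pverts = ?V, parcs = ?P\<rparr>"
    by (auto simp: mk_symmetric_def two_vertex_graph_def)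
  have iff: "Digraph_Component.connected ?G \<longleftrightarrow> (\<forall>u\<in>?V. \<forall>v\<in>?V. (u, v) \<in> rtrancl_on ?V ?P)"
    unfolding connected_def strongly_connected_def reachable_def G by simp
  have "(vertex_v, vertex_u) \<notin> rtrancl_on ?V {}"
    by (auto elim: rtrancl_on.cases)
  moreover have "(u, v) \<in> rtrancl_on ?V ?P" if "T \<noteq> {}" "u \<in> ?V" "v \<in> ?V" for u v
  proof (cases "u = v")
    case True
    then show ?thesis using that(2) by (simp add: rtrancl_on_refl)
  next
    case False
    then have "(u, v) \<in> ?P" using that by auto
    with that(2,3) show ?thesis
      by (blast intro: rtrancl_on_into_rtrancl_on[OF rtrancl_on_refl])
  qed
  ultimately show ?thesis unfolding iff by (cases "T = {}") auto
qed

lemma is_labeled_graph_two_vertex_graph: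
  assumes "ls \<noteq> []" "\<And>x y. (x, y) \<in> set ls \<Longrightarrow> x \<noteq> 0 \<and> y \<noteq> 0"
  shows "is_labeled_graph (two_vertex_graph ls)"
proof -
  have "lgraph (two_vertex_graph ls) =
      (lgraph (two_vertex_graph ls))\<lparr>arcs := {..<length ls}\<rparr>"
    by (simp add: two_vertex_graph_def)
  then have "Digraph_Component.connected (lgraph (two_vertex_graph ls))"
    using connected_two_vertex_graph[where ls = ls and T = "{..<length ls}"] assms(1)
    by (metis lessThan_iff length_greater_0_conv empty_iff)
  moreover have "fst (ls ! i) \<noteq> 0 \<and> snd (ls ! i) \<noteq> 0" if "i < length ls" for i
    using assms(2) nth_mem[OF that] by (metis prod.collapse)
  ultimately show ?thesis
    by (auto simp: is_labeled_graph_def two_vertex_graph_def wf_digraph_def)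
qed

lemma maximal_tree_two_vertex_graph:
  "ls \<noteq> [] \<Longrightarrow> maximal_tree {0} (lgraph (two_vertex_graph ls))"
  unfolding maximal_tree_def connected_two_vertex_graph
  by (auto simp: two_vertex_graph_def)

lemma group_two_vertex_group: "group (two_vertex_group ls)"
  by (simp add: two_vertex_group_def labeled_graph_group_def pi1_def group_presented_group)

definition G\<^sub>1 :: "nat \<Rightarrow> nat \<Rightarrow> (two_vertices, nat, int) gog_gen word set monoid" where
  "G\<^sub>1 k n = two_vertex_group [(int k, int (k * n)), (int (k * n), int k)]"

definition G\<^sub>2 :: "nat \<Rightarrow> nat \<Rightarrow> (two_vertices, nat, int) gog_gen word set monoid" where
  "G\<^sub>2 k n = two_vertex_group ((int k, int (k * n)) # replicate k (int n, 1))"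

definition G\<^sub>3 :: "nat \<Rightarrow> nat \<Rightarrow> nat \<Rightarrow> (two_vertices, nat, int) gog_gen word set monoid" where
  "G\<^sub>3 k n p = two_vertex_group
    (replicate k (int n, 1) @ replicate (k - p) (1, int n) @ [(int p, int (p * n))])"

definition G\<^sub>4 :: "nat \<Rightarrow> nat \<Rightarrow> (two_vertices, nat, int) gog_gen word set monoid" where
  "G\<^sub>4 k n = two_vertex_group
    (replicate k (int n, 1) @ [(1, int n)] @ replicate ((k - 1) div n) (int n, int (n ^ 2)))"

definition the_lattices ::
    "nat \<Rightarrow> nat \<Rightarrow> (two_vertices, nat, int) gog_gen word set monoid set" where
  "the_lattices k n =
    {G\<^sub>1 k n, G\<^sub>2 k n} \<union>
    {G\<^sub>3 k n p | p. p dvd n \<and> 1 < p \<and> p < k} \<union>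
    (if n < k \<and> [k = 1] (mod n) then {G\<^sub>4 k n} else {})"

end

theory Submission
  imports Defs "HOL-Combinatorics.Transposition"
begin

text \<open>
  Every label pair of the four groups is \<open>(n * y, y)\<close> or \<open>(x, n * x)\<close>, and in each case the small labels of
  either kind add up to \<open>k\<close>. By Bass--Serre normal forms each group acts simply transitively on the
  integer points of the lines over \<open>v\<close> in a tree of strips, and likewise over \<open>u\<close>. Such a tree is
  determined by \<open>n\<close> and \<open>k\<close>: from every point of every line the strips leading out and in are counted
  by \<open>k\<close>, so an isomorphism between two of them is built outwards from the base line, matching at each
  line the strip leading back with its counterpart. Joining points over \<open>v\<close> that have a common
  neighbour over \<open>u\<close> then gives isomorphic Cayley graphs.
\<close>

subsection \<open>Cayley graphs from a common neighbour relation\<close>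

text \<open>The isomorphism of trees need not respect either group action, so the Cayley graphs have
  to be read off from incidences alone. Under the simply transitive actions, the points over
  \<open>u\<close> near a point over \<open>v\<close> form a left translate g S with a fixed finite
  S, and two translates g S and h S meet exactly when the quotient of g and h lies in S S^-1. The
  normal forms are not established beforehand. Words act on points by explicit formulas, and an
  evaluation of points in the group inverts the orbit map, as in van der Waerden's argument for free
  products. Small labels are added up for the following reason: the edge group of an edge with
  labels \<open>n * y\<close> and \<open>y\<close> translates a strip by \<open>y\<close> cells,
  which leaves \<open>y\<close> offsets and hence \<open>y\<close> strips of this kind at every
  point. Only the total of these \<open>y\<close> is visible in the tree, not its distribution over
  the edges.\<close>

definition difference_set :: "('a, 'c) monoid_scheme \<Rightarrow> 'a set \<Rightarrow> 'a set" where
  "difference_set G S = {s \<otimes>\<^bsub>G\<^esub> inv\<^bsub>G\<^esub> t | s t. s \<in> S \<and> t \<in> S} - {\<one>\<^bsub>G\<^esub>}"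

text \<open>Inverting a difference swaps its two factors, which gives symmetry. Since
  \<open>S\<close> contains the identity, each other element of \<open>S\<close> is itself a
  difference, so nothing is lost in the generated subgroup.\<close>

lemma (in group) cayley_gen_set_difference_set:
  assumes S: "finite S" "S \<subseteq> carrier G" "\<one> \<in> S" "generate G S = carrier G"
  shows "cayley_gen_set G (difference_set G S)"
proof -
  let ?D = "difference_set G S"
  have "finite {s \<otimes> inv t | s t. s \<in> S \<and> t \<in> S}"
    using S(1) by (rule finite_image_set2[of "\<lambda>s. s \<in> S" "\<lambda>t. t \<in> S", simplified])
  then have "finite ?D" by (simp add: difference_set_def)
  moreover have D: "?D \<subseteq> carrier G" using S(2) by (auto simp: difference_set_def)
  moreover have "inv x \<in> ?D" if "x \<in> ?D" for x
  proof -
    from that obtain s t where st: "s \<in> S" "t \<in> S" "x = s \<otimes> inv t" "x \<noteq> \<one>"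
      by (auto simp: difference_set_def)
    then have "inv x = t \<otimes> inv s" using S(2) by (simp add: inv_mult_group subset_iff)
    moreover have "inv x \<noteq> \<one>" using st(4) that D by (auto simp: inv_eq_1_iff)
    ultimately show ?thesis using st by (auto simp: difference_set_def)
  qed
  moreover have "generate G ?D = carrier G"
  proof
    show "generate G ?D \<subseteq> carrier G" using D generate_incl by blast
    have "S \<subseteq> generate G ?D"
    proof
      fix s assume s: "s \<in> S"
      show "s \<in> generate G ?D"
      proof (cases "s = \<one>")
        case False
        have "s = s \<otimes> inv \<one>" using s S(2) by auto
        then have "s \<in> ?D" using s S(3) False unfolding difference_set_def by blast
        then show ?thesis by (rule generate.incl)
      qed (simp add: generate.one)
    qed
    then show "carrier G \<subseteq> generate G ?D"
      using generate_subgroup_incl[OF _ generate_is_subgroup[OF D]] S(4) by blast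
  qed
  ultimately show ?thesis by (auto simp: cayley_gen_set_def difference_set_def)
qed

lemma (in group) difference_set_iff:
  assumes S: "S \<subseteq> carrier G" and gh: "g \<in> carrier G" "h \<in> carrier G"
  shows "inv g \<otimes> h \<in> difference_set G S \<longleftrightarrow> g \<noteq> h \<and> (\<lambda>s. g \<otimes> s) ` S \<inter> (\<lambda>s. h \<otimes> s) ` S \<noteq> {}"
proof -
  have "inv g \<otimes> h = s \<otimes> inv t \<longleftrightarrow> g \<otimes> s = h \<otimes> t" if "s \<in> S" "t \<in> S" for s t
  proof -
    have st: "s \<in> carrier G" "t \<in> carrier G" using that S by auto
    have "inv g \<otimes> h = s \<otimes> inv t \<longleftrightarrow> h = g \<otimes> (s \<otimes> inv t)"
      using gh st by (metis inv_closed inv_solve_left m_closed)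
    also have "\<dots> \<longleftrightarrow> h \<otimes> t = g \<otimes> s"
      using gh st by (metis inv_closed inv_solve_right m_assoc m_closed)
    finally show ?thesis by metis
  qed
  moreover have "inv g \<otimes> h = \<one> \<longleftrightarrow> g = h"
    using gh by (metis inv_closed inv_equality inv_inv l_inv)
  ultimately show ?thesis unfolding difference_set_def by blast
qed

text \<open>Vertices are adjacent when their translates of \<open>S\<close> meet. The injective map
  \<open>\<Psi>\<close> preserves intersections of translates, so \<open>\<Phi>\<close> preserves
  adjacency. In the application \<open>\<Phi>\<close> comes from the points over \<open>v\<close>
  and \<open>\<Psi>\<close> from those over \<open>u\<close>.\<close>

lemma admit_isomorphic_Cayley_graphsI:
  fixes G :: "('a, 'c) monoid_scheme" and H :: "('b, 'd) monoid_scheme"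
  assumes "group G" "group H"
    and "finite S" "S \<subseteq> carrier G" "\<one>\<^bsub>G\<^esub> \<in> S" "generate G S = carrier G"
    and "finite S'" "S' \<subseteq> carrier H" "\<one>\<^bsub>H\<^esub> \<in> S'" "generate H S' = carrier H"
    and \<Phi>: "bij_betw \<Phi> (carrier G) (carrier H)" and \<Psi>: "bij_betw \<Psi> (carrier G) (carrier H)"
    and \<Psi>_\<Phi>: "\<And>g. g \<in> carrier G \<Longrightarrow> \<Psi> ` (\<lambda>s. g \<otimes>\<^bsub>G\<^esub> s) ` S = (\<lambda>s. \<Phi> g \<otimes>\<^bsub>H\<^esub> s) ` S'"
  shows "admit_isomorphic_Cayley_graphs G H"
proof -
  let ?C = "difference_set G S" and ?D = "difference_set H S'"
  interpret G: group G by fact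
  interpret H: group H by fact
  have \<Phi>_car: "\<Phi> g \<in> carrier H" if "g \<in> carrier G" for g using \<Phi> that by (auto dest: bij_betwE)
  have \<Phi>_eq: "\<Phi> g = \<Phi> h \<longleftrightarrow> g = h" if "g \<in> carrier G" "h \<in> carrier G" for g h
    using \<Phi> that by (meson bij_betw_def inj_on_eq_iff)
  have key: "inv\<^bsub>G\<^esub> g \<otimes>\<^bsub>G\<^esub> h \<in> ?C \<longleftrightarrow> inv\<^bsub>H\<^esub> (\<Phi> g) \<otimes>\<^bsub>H\<^esub> \<Phi> h \<in> ?D"
    if gh: "g \<in> carrier G" "h \<in> carrier G" for g h
  proof -
    let ?T = "(\<lambda>s. g \<otimes>\<^bsub>G\<^esub> s) ` S" and ?U = "(\<lambda>s. h \<otimes>\<^bsub>G\<^esub> s) ` S"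
    have "\<Psi> ` (?T \<inter> ?U) = \<Psi> ` ?T \<inter> \<Psi> ` ?U"
      using gh assms(4) by (intro inj_on_image_Int[OF bij_betw_imp_inj_on[OF \<Psi>]]) auto
    then have "?T \<inter> ?U \<noteq> {} \<longleftrightarrow>
        (\<lambda>s. \<Phi> g \<otimes>\<^bsub>H\<^esub> s) ` S' \<inter> (\<lambda>s. \<Phi> h \<otimes>\<^bsub>H\<^esub> s) ` S' \<noteq> {}"
      unfolding \<Psi>_\<Phi>[OF gh(1)] \<Psi>_\<Phi>[OF gh(2)] by (metis image_is_empty)
    then show ?thesis
      using G.difference_set_iff[OF assms(4) gh] H.difference_set_iff[OF assms(8) gh[THEN \<Phi>_car]]
        \<Phi>_eq[OF gh] by simp
  qed
  have gen: "cayley_gen_set G ?C" "cayley_gen_set H ?D"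
    using G.cayley_gen_set_difference_set[OF assms(3-6)] H.cayley_gen_set_difference_set[OF assms(7-10)] .
  then have C_car: "?C \<subseteq> carrier G" and D_car: "?D \<subseteq> carrier H"
    by (simp_all add: cayley_gen_set_def)
  \<comment> \<open>As \<open>\<Phi>\<close> is not a homomorphism, the label of the image arc
    varies with \<open>g\<close>; it is recomputed from the images of the two endpoints.\<close>
  define A where "A = (\<lambda>(g, s). (\<Phi> g, inv\<^bsub>H\<^esub> (\<Phi> g) \<otimes>\<^bsub>H\<^esub> \<Phi> (g \<otimes>\<^bsub>G\<^esub> s)))"
  define f where "f = \<lparr>iso_verts = \<Phi>, iso_arcs = A, iso_head = (\<lambda>(h, s). h \<otimes>\<^bsub>H\<^esub> s), iso_tail = fst\<rparr>"
  have inj: "inj_on A (carrier G \<times> ?C)"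
  proof (rule inj_onI, clarify)
    fix g s g' s'
    assume h: "g \<in> carrier G" "s \<in> ?C" "g' \<in> carrier G" "s' \<in> ?C" "A (g, s) = A (g', s')"
    then have g: "g' = g" using \<Phi>_eq by (auto simp: A_def)
    have "\<Phi> (g \<otimes>\<^bsub>G\<^esub> s) = \<Phi> (g \<otimes>\<^bsub>G\<^esub> s')"
      using h g C_car \<Phi>_car by (auto simp: A_def subset_iff)
    then show "g = g' \<and> s = s'" using h g C_car \<Phi>_eq by (auto simp: subset_iff)
  qed
  have img: "A ` (carrier G \<times> ?C) = carrier H \<times> ?D"
  proof
    show "A ` (carrier G \<times> ?C) \<subseteq> carrier H \<times> ?D"
    proof clarify
      fix g s h u assume gs: "g \<in> carrier G" "s \<in> ?C" and A: "(h, u) = A (g, s)"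
      have s: "s \<in> carrier G" using gs C_car by auto
      have "inv\<^bsub>G\<^esub> g \<otimes>\<^bsub>G\<^esub> (g \<otimes>\<^bsub>G\<^esub> s) \<in> ?C" using gs s by (simp flip: G.m_assoc)
      then show "h \<in> carrier H \<and> u \<in> ?D"
        using key[of g "g \<otimes>\<^bsub>G\<^esub> s"] A gs s \<Phi>_car by (auto simp: A_def)
    qed
    show "carrier H \<times> ?D \<subseteq> A ` (carrier G \<times> ?C)"
    proof clarify
      fix h u assume hu: "h \<in> carrier H" "u \<in> ?D"
      then have u: "u \<in> carrier H" using D_car by auto
      obtain g g' where g: "g \<in> carrier G" "h = \<Phi> g" "g' \<in> carrier G" "h \<otimes>\<^bsub>H\<^esub> u = \<Phi> g'"
        using \<Phi> hu u by (metis H.m_closed bij_betw_imp_surj_on imageE)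
      have "inv\<^bsub>H\<^esub> (\<Phi> g) \<otimes>\<^bsub>H\<^esub> \<Phi> g' = u"
        using g hu u by (metis H.inv_solve_left H.m_closed)
      moreover from this have "inv\<^bsub>G\<^esub> g \<otimes>\<^bsub>G\<^esub> g' \<in> ?C" using key g hu by metis
      moreover have "g \<otimes>\<^bsub>G\<^esub> (inv\<^bsub>G\<^esub> g \<otimes>\<^bsub>G\<^esub> g') = g'"
        using g by (simp flip: G.m_assoc)
      ultimately show "(h, u) \<in> A ` (carrier G \<times> ?C)"
        using g by (intro image_eqI[of _ _ "(g, inv\<^bsub>G\<^esub> g \<otimes>\<^bsub>G\<^esub> g')"]) (auto simp: A_def)
    qed
  qed
  have "pre_digraph.digraph_isomorphism (Cay G (?C)) f"
  proof -
    have "wf_digraph (Cay G (?C))"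
      using C_car by unfold_locales (auto simp: Cay_def)
    moreover have "\<Phi> g \<otimes>\<^bsub>H\<^esub> (inv\<^bsub>H\<^esub> (\<Phi> g) \<otimes>\<^bsub>H\<^esub> \<Phi> (g \<otimes>\<^bsub>G\<^esub> s)) = \<Phi> (g \<otimes>\<^bsub>G\<^esub> s)"
      if "g \<in> carrier G" "s \<in> ?C" for g s
      using that C_car \<Phi>_car by (simp add: subset_iff flip: H.m_assoc)
    ultimately show ?thesis
      using inj bij_betw_imp_inj_on[OF \<Phi>]
      by (auto simp: pre_digraph.digraph_isomorphism_def f_def Cay_def A_def)
  qed
  moreover have "Cay H (?D) = app_iso f (Cay G (?C))"
    using img bij_betw_imp_surj_on[OF \<Phi>] by (simp add: app_iso_def f_def Cay_def)
  ultimately have "digraph_iso (Cay G (?C)) (Cay H (?D))"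
    unfolding digraph_iso_def by blast
  then show ?thesis
    unfolding admit_isomorphic_Cayley_graphs_def using gen by blast
qed

subsection \<open>Reduced paths of strips\<close>

text \<open>
  Model of the vertices of the common complex. A path is a list of strip crossings, the most recent
  first; it leads from a line over \<open>v\<close> to a line over \<open>v\<close> or \<open>u\<close> according to the parity of its length,
  \<open>True\<close> standing for even. A point \<open>(p, m)\<close> is the integer point \<open>m\<close> of the line that \<open>p\<close> leads to.
  The step \<open>Out r \<alpha>\<close> takes \<open>r + n * j\<close> to \<open>j\<close>, the step \<open>In \<alpha>\<close> takes \<open>j\<close> to \<open>n * j\<close>; hence the way back
  along \<open>In \<alpha>\<close> is \<open>Out 0 \<alpha>\<close>, and the way back along \<open>Out r \<alpha>\<close> is \<open>In \<alpha>\<close> up to a translation by \<open>r\<close>.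
  Strips leaving a line of parity \<open>q\<close> by an \<open>Out\<close> step have labels in \<open>S q\<close>, so those leaving it by
  an \<open>In\<close> step have labels in \<open>S (\<not> q)\<close>.
\<close>

datatype 's step = Out int 's | In 's

definition out_label :: "'s step list \<Rightarrow> 's option" where
  "out_label p = (case p of Out r \<alpha> # _ \<Rightarrow> Some \<alpha> | _ \<Rightarrow> None)"

definition in_label :: "'s step list \<Rightarrow> 's option" where
  "in_label p = (case p of In \<alpha> # _ \<Rightarrow> Some \<alpha> | _ \<Rightarrow> None)"

lemma label_simps [simp]:
  "out_label [] = None" "out_label (Out r \<alpha> # p) = Some \<alpha>" "out_label (In \<alpha> # p) = None"
  "in_label [] = None" "in_label (Out r \<alpha> # p) = None" "in_label (In \<alpha> # p) = Some \<alpha>"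
  by (simp_all add: out_label_def in_label_def)

lemma out_label_eq_Some: "out_label p = Some \<alpha> \<longleftrightarrow> (\<exists>r p'. p = Out r \<alpha> # p')"
  and in_label_eq_Some: "in_label p = Some \<alpha> \<longleftrightarrow> (\<exists>p'. p = In \<alpha> # p')"
  by (auto simp: out_label_def in_label_def split: list.splits step.splits)

text \<open>The last condition of each clause forbids backtracking. Only the points of residue 0 lie
  on the strip by which an \<open>In\<close> step arrived, whereas \<open>In \<alpha>\<close>
  retraces \<open>Out r \<alpha>\<close> for every \<open>r\<close>.\<close>

fun step_ok :: "int \<Rightarrow> (bool \<Rightarrow> 's set) \<Rightarrow> 's step list \<Rightarrow> 's step \<Rightarrow> bool" where
  "step_ok n S p (Out r \<alpha>) \<longleftrightarrow>
    0 \<le> r \<and> r < n \<and> \<alpha> \<in> S (even (length p)) \<and> (r = 0 \<longrightarrow> in_label p \<noteq> Some \<alpha>)"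
| "step_ok n S p (In \<alpha>) \<longleftrightarrow> \<alpha> \<in> S (odd (length p)) \<and> out_label p \<noteq> Some \<alpha>"

primrec reduced :: "int \<Rightarrow> (bool \<Rightarrow> 's set) \<Rightarrow> 's step list \<Rightarrow> bool" where
  "reduced n S [] \<longleftrightarrow> True"
| "reduced n S (s # p) \<longleftrightarrow> step_ok n S p s \<and> reduced n S p"

lemma label_mem:
  assumes "reduced n S p"
  shows "in_label p = Some \<alpha> \<Longrightarrow> \<alpha> \<in> S (even (length p))"
    and "out_label p = Some \<alpha> \<Longrightarrow> \<alpha> \<in> S (odd (length p))"
  using assms by (auto simp: in_label_eq_Some out_label_eq_Some)

section \<open>Points and the crossing maps\<close>

type_synonym 's point = "'s step list \<times> int"

definition points :: "int \<Rightarrow> (bool \<Rightarrow> 's set) \<Rightarrow> bool \<Rightarrow> 's point set" where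
  "points n S q = {(p, m). reduced n S p \<and> even (length p) = q}"

definition shift :: "int \<Rightarrow> 's point \<Rightarrow> 's point" where
  "shift c v = (fst v, snd v + c)"

fun cross_out :: "int \<Rightarrow> 's \<Rightarrow> 's point \<Rightarrow> 's point" where
  "cross_out n \<alpha> (p, m) =
    (if m mod n = 0 \<and> in_label p = Some \<alpha> then tl p else Out (m mod n) \<alpha> # p, m div n)"

text \<open>A step that would backtrack deletes the last step instead of extending the path. The
  residue stored in \<open>Out\<close> restores the part of the position that the division by
  \<open>n\<close> had discarded.\<close>

fun cross_in :: "int \<Rightarrow> 's \<Rightarrow> 's point \<Rightarrow> 's point" where
  "cross_in n \<alpha> (Out r \<beta> # p, m) = (if \<beta> = \<alpha> then (p, r + n * m) else (In \<alpha> # Out r \<beta> # p, n * m))"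
| "cross_in n \<alpha> (p, m) = (In \<alpha> # p, n * m)"

lemma cross_in_eq_if:
  "cross_in n \<alpha> (p, m) =
    (if out_label p = Some \<alpha> then (tl p, (case hd p of Out r _ \<Rightarrow> r) + n * m) else (In \<alpha> # p, n * m))"
  by (cases "(n, \<alpha>, (p, m))" rule: cross_in.cases) auto

lemma shift_0 [simp]: "shift 0 v = v" and shift_shift [simp]: "shift c (shift d v) = shift (d + c) v"
  by (simp_all add: shift_def)

lemma shift_points [simp]: "shift c v \<in> points n S q \<longleftrightarrow> v \<in> points n S q"
  by (auto simp: points_def shift_def)

lemma cross_out_points:
  assumes "n > 0" "v \<in> points n S q" "\<alpha> \<in> S q"
  shows "cross_out n \<alpha> v \<in> points n S (\<not> q)"
  using assms by (cases v) (auto simp: points_def in_label_eq_Some)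

lemma cross_in_points:
  assumes "v \<in> points n S q" "\<alpha> \<in> S (\<not> q)"
  shows "cross_in n \<alpha> v \<in> points n S (\<not> q)"
  using assms by (cases v) (auto simp: points_def cross_in_eq_if out_label_eq_Some)

lemma cross_in_cross_out:
  assumes "n > 0" "v \<in> points n S q"
  shows "cross_in n \<alpha> (cross_out n \<alpha> v) = v"
  using assms by (cases v) (auto simp: points_def cross_in_eq_if in_label_eq_Some)

lemma cross_out_cross_in:
  assumes "n > 0" "v \<in> points n S q"
  shows "cross_out n \<alpha> (cross_in n \<alpha> v) = v"
proof -
  \<comment> \<open>After a cancelling \<open>cross_in\<close>, crossing out must restore the
    deleted step. The other branch of \<open>cross_out\<close> would require residue 0, hence
    \<open>r = 0\<close>, together with a matching \<open>In\<close> label; reducedness excludes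
    this.\<close>
  have *: "r = 0" if "n dvd r" "0 \<le> r" "r < n" for r
    using that zdvd_imp_le[of n r] by fastforce
  show ?thesis
    using assms by (cases v) (auto simp: points_def cross_in_eq_if out_label_eq_Some dest: *)
qed

lemma snd_cross_out: "snd (cross_out n \<alpha> v) = snd v div n"
  by (cases v) simp

lemma snd_cross_in_div:
  assumes "n > 0" "v \<in> points n S q"
  shows "snd (cross_in n \<alpha> v) div n = snd v"
  using assms by (cases v) (auto simp: points_def cross_in_eq_if out_label_eq_Some)

lemma cross_out_shift:
  "n > 0 \<Longrightarrow> cross_out n \<alpha> (shift (n * c) v) = shift c (cross_out n \<alpha> v)"
  by (cases v) (auto simp: shift_def)

lemma cross_in_shift: "cross_in n \<alpha> (shift c v) = shift (n * c) (cross_in n \<alpha> v)"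
  by (cases v) (auto simp: shift_def cross_in_eq_if algebra_simps)

definition crossings :: "int \<Rightarrow> (bool \<Rightarrow> 's set) \<Rightarrow> 's point \<Rightarrow> 's point set" where
  "crossings n S v =
    (let q = even (length (fst v)) in (\<lambda>\<alpha>. cross_out n \<alpha> v) ` S q \<union> (\<lambda>\<alpha>. cross_in n \<alpha> v) ` S (\<not> q))"

text \<open>The unit shifts before and after the crossing bring the generators of both vertex groups
  into the resulting generating set.\<close>

definition nearby :: "int \<Rightarrow> (bool \<Rightarrow> 's set) \<Rightarrow> 's point \<Rightarrow> 's point set" where
  "nearby n S v = (\<Union>d\<in>{0, 1}. \<Union>c\<in>{0, 1}. shift c ` crossings n S (shift d v))"

lemma crossings_points:
  assumes "n > 0" "v \<in> points n S q"
  shows "crossings n S v \<subseteq> points n S (\<not> q)"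
proof -
  have q: "even (length (fst v)) = q" using assms(2) by (auto simp: points_def)
  show ?thesis
    unfolding crossings_def Let_def q
    by (intro Un_least image_subsetI cross_out_points[OF assms] cross_in_points[OF assms(2)])
qed

lemma nearby_points:
  assumes "n > 0" "v \<in> points n S q"
  shows "nearby n S v \<subseteq> points n S (\<not> q)"
proof -
  have "shift c u \<in> points n S (\<not> q)" if "u \<in> crossings n S (shift d v)" for c d u
    using that crossings_points[OF assms(1), of "shift d v" S q] assms(2) by auto
  then show ?thesis by (auto simp only: nearby_def)
qed

text \<open>
  Corrects a bijection by a transposition so that the strip just crossed corresponds to the strip
  just crossed on the other side. This makes \<open>relabel\<close> below preserve reducedness and crossings.
\<close>

definition fit :: "('s \<Rightarrow> 't) \<Rightarrow> 's option \<Rightarrow> 't option \<Rightarrow> 's \<Rightarrow> 't" where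
  "fit \<phi> x y = (case (x, y) of (Some \<alpha>, Some \<beta>) \<Rightarrow> transpose (\<phi> \<alpha>) \<beta> \<circ> \<phi> | _ \<Rightarrow> \<phi>)"

lemma bij_betw_fit:
  assumes \<phi>: "bij_betw \<phi> A B" and "\<And>\<alpha>. x = Some \<alpha> \<Longrightarrow> \<alpha> \<in> A" "\<And>\<beta>. y = Some \<beta> \<Longrightarrow> \<beta> \<in> B"
  shows "bij_betw (fit \<phi> x y) A B"
proof (cases "\<exists>\<alpha> \<beta>. x = Some \<alpha> \<and> y = Some \<beta>")
  case True
  then obtain \<alpha> \<beta> where xy: "x = Some \<alpha>" "y = Some \<beta>" by blast
  then have "\<phi> \<alpha> \<in> B" "\<beta> \<in> B" using assms by (auto dest: bij_betwE)
  then have "bij_betw (transpose (\<phi> \<alpha>) \<beta>) B B" by simp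
  with \<phi> show ?thesis by (simp add: fit_def xy bij_betw_trans)
next
  case False
  then have "fit \<phi> x y = \<phi>" by (auto simp: fit_def split: option.splits)
  with \<phi> show ?thesis by simp
qed

lemma fit_eq_Some_iff:
  assumes \<phi>: "bij_betw \<phi> A B" and "x = None \<longleftrightarrow> y = None"
    and "\<And>\<alpha>. x = Some \<alpha> \<Longrightarrow> \<alpha> \<in> A" "\<And>\<beta>. y = Some \<beta> \<Longrightarrow> \<beta> \<in> B" and \<alpha>: "\<alpha> \<in> A"
  shows "y = Some (fit \<phi> x y \<alpha>) \<longleftrightarrow> x = Some \<alpha>"
proof (cases x)
  case None
  then show ?thesis using assms(2) by simp
next
  case (Some \<alpha>')
  then obtain \<beta> where y: "y = Some \<beta>" using assms(2) by (cases y) auto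
  have "fit \<phi> x y \<alpha>' = \<beta>" by (simp add: fit_def Some y)
  moreover have "inj_on (fit \<phi> x y) A"
    using bij_betw_fit[OF \<phi> assms(3,4)] by (simp add: bij_betw_def)
  ultimately show ?thesis using \<alpha> assms(3)[OF Some]
    by (auto simp: Some y dest: inj_onD[of _ _ \<alpha>' \<alpha>])
qed

text \<open>An \<open>Out\<close> step can only retrace an \<open>In\<close> step and conversely, so
  the labels of \<open>Out\<close> steps are fitted to \<open>in_label\<close> and those of
  \<open>In\<close> steps to \<open>out_label\<close>. Residues are kept, so positions on
  corresponding lines agree.\<close>

fun relabel_step :: "(bool \<Rightarrow> 's \<Rightarrow> 't) \<Rightarrow> 's step list \<Rightarrow> 't step list \<Rightarrow> 's step \<Rightarrow> 't step" where
  "relabel_step \<phi> p p' (Out r \<alpha>) = Out r (fit (\<phi> (even (length p))) (in_label p) (in_label p') \<alpha>)"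
| "relabel_step \<phi> p p' (In \<alpha>) = In (fit (\<phi> (odd (length p))) (out_label p) (out_label p') \<alpha>)"

primrec relabel :: "(bool \<Rightarrow> 's \<Rightarrow> 't) \<Rightarrow> 's step list \<Rightarrow> 't step list" where
  "relabel \<phi> [] = []"
| "relabel \<phi> (s # p) = relabel_step \<phi> p (relabel \<phi> p) s # relabel \<phi> p"

lemma length_relabel [simp]: "length (relabel \<phi> p) = length p"
  by (induction p) auto

lemma label_relabel_None [simp]:
  "in_label (relabel \<phi> p) = None \<longleftrightarrow> in_label p = None"
  "out_label (relabel \<phi> p) = None \<longleftrightarrow> out_label p = None"
proof -
  have "(in_label (relabel \<phi> p) = None \<longleftrightarrow> in_label p = None) \<and>
    (out_label (relabel \<phi> p) = None \<longleftrightarrow> out_label p = None)"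
  proof (cases p)
    case (Cons s p')
    then show ?thesis by (cases s) auto
  qed simp
  then show "in_label (relabel \<phi> p) = None \<longleftrightarrow> in_label p = None"
    "out_label (relabel \<phi> p) = None \<longleftrightarrow> out_label p = None" by auto
qed

section \<open>Tree isomorphisms induced by bijections of strip labels\<close>

context
  fixes n :: int and S :: "bool \<Rightarrow> 's set" and S' :: "bool \<Rightarrow> 't set" and \<phi> :: "bool \<Rightarrow> 's \<Rightarrow> 't"
  assumes n: "n > 0" and \<phi>: "\<And>q. bij_betw (\<phi> q) (S q) (S' q)"
begin

lemma fit_in:
  assumes "reduced n S p" "reduced n S' (relabel \<phi> p)"
  defines "f \<equiv> fit (\<phi> (even (length p))) (in_label p) (in_label (relabel \<phi> p))"
  shows "bij_betw f (S (even (length p))) (S' (even (length p)))"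
    and "\<alpha> \<in> S (even (length p)) \<Longrightarrow> in_label (relabel \<phi> p) = Some (f \<alpha>) \<longleftrightarrow> in_label p = Some \<alpha>"
proof -
  have *: "\<alpha> \<in> S (even (length p))" if "in_label p = Some \<alpha>" for \<alpha>
    using that label_mem(1)[OF assms(1)] by blast
  have **: "\<alpha> \<in> S' (even (length p))" if "in_label (relabel \<phi> p) = Some \<alpha>" for \<alpha>
    using that label_mem(1)[OF assms(2)] by simp
  show "bij_betw f (S (even (length p))) (S' (even (length p)))"
    unfolding f_def by (rule bij_betw_fit[OF \<phi> * **])
  show "in_label (relabel \<phi> p) = Some (f \<alpha>) \<longleftrightarrow> in_label p = Some \<alpha>" if "\<alpha> \<in> S (even (length p))"
    unfolding f_def by (rule fit_eq_Some_iff[OF \<phi> _ * ** that]) simp_all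
qed

lemma fit_out:
  assumes "reduced n S p" "reduced n S' (relabel \<phi> p)"
  defines "f \<equiv> fit (\<phi> (odd (length p))) (out_label p) (out_label (relabel \<phi> p))"
  shows "bij_betw f (S (odd (length p))) (S' (odd (length p)))"
    and "\<alpha> \<in> S (odd (length p)) \<Longrightarrow> out_label (relabel \<phi> p) = Some (f \<alpha>) \<longleftrightarrow> out_label p = Some \<alpha>"
proof -
  have *: "\<alpha> \<in> S (odd (length p))" if "out_label p = Some \<alpha>" for \<alpha>
    using that label_mem(2)[OF assms(1)] by blast
  have **: "\<alpha> \<in> S' (odd (length p))" if "out_label (relabel \<phi> p) = Some \<alpha>" for \<alpha>
    using that label_mem(2)[OF assms(2)] by simp
  show "bij_betw f (S (odd (length p))) (S' (odd (length p)))"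
    unfolding f_def by (rule bij_betw_fit[OF \<phi> * **])
  show "out_label (relabel \<phi> p) = Some (f \<alpha>) \<longleftrightarrow> out_label p = Some \<alpha>" if "\<alpha> \<in> S (odd (length p))"
    unfolding f_def by (rule fit_eq_Some_iff[OF \<phi> _ * ** that]) simp_all
qed

text \<open>The fitted bijection matches the label whose use would backtrack with its counterpart,
  so the admissible steps on the two sides correspond as well.\<close>

lemma bij_betw_relabel_step:
  assumes "reduced n S p" "reduced n S' (relabel \<phi> p)"
  shows "bij_betw (relabel_step \<phi> p (relabel \<phi> p)) {s. step_ok n S p s} {s. step_ok n S' (relabel \<phi> p) s}"
    (is "bij_betw ?f ?A ?B")
  unfolding bij_betw_def
proof
  note i = fit_in[OF assms] and o = fit_out[OF assms]
  show "inj_on ?f ?A"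
  proof (rule inj_onI)
    fix s t assume "s \<in> ?A" "t \<in> ?A" "?f s = ?f t"
    then show "s = t"
      using bij_betw_imp_inj_on[OF i(1)] bij_betw_imp_inj_on[OF o(1)]
      by (cases s; cases t) (auto dest: inj_onD)
  qed
  have "?f s \<in> ?B" if "s \<in> ?A" for s
    using that bij_betwE[OF i(1)] bij_betwE[OF o(1)] i(2) o(2) by (cases s) auto
  moreover have "s' \<in> ?f ` ?A" if "s' \<in> ?B" for s'
  proof (cases s')
    case (Out r \<beta>)
    then have "\<beta> \<in> S' (even (length p))" using that by simp
    then obtain \<alpha> where "\<alpha> \<in> S (even (length p))"
      "\<beta> = fit (\<phi> (even (length p))) (in_label p) (in_label (relabel \<phi> p)) \<alpha>"
      using bij_betw_imp_surj_on[OF i(1)] by blast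
    then have "Out r \<alpha> \<in> ?A" "s' = ?f (Out r \<alpha>)" using that i(2) Out by auto
    then show ?thesis by blast
  next
    case (In \<beta>)
    then have "\<beta> \<in> S' (odd (length p))" using that by simp
    then obtain \<alpha> where "\<alpha> \<in> S (odd (length p))"
      "\<beta> = fit (\<phi> (odd (length p))) (out_label p) (out_label (relabel \<phi> p)) \<alpha>"
      using bij_betw_imp_surj_on[OF o(1)] by blast
    then have "In \<alpha> \<in> ?A" "s' = ?f (In \<alpha>)" using that o(2) In by auto
    then show ?thesis by blast
  qed
  ultimately show "?f ` ?A = ?B" by blast
qed

lemma reduced_relabel: "reduced n S p \<Longrightarrow> reduced n S' (relabel \<phi> p)"
proof (induction p)
  case (Cons s p)
  then show ?case using bij_betw_relabel_step[of p] by (auto dest: bij_betwE)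
qed simp

lemma bij_betw_relabel: "bij_betw (relabel \<phi>) {p. reduced n S p} {p. reduced n S' p}"
  unfolding bij_betw_def
proof
  have "p = p'" if "reduced n S p" "reduced n S p'" "relabel \<phi> p = relabel \<phi> p'" for p p'
    using that
  proof (induction p arbitrary: p')
    case Nil
    then show ?case by (cases p') auto
  next
    case (Cons s p)
    then obtain s' p'' where p': "p' = s' # p''" by (cases p') auto
    then have "p = p''" using Cons by auto
    moreover have "s = s'"
      using Cons.prems p' \<open>p = p''\<close> bij_betw_imp_inj_on[OF bij_betw_relabel_step[of p]] reduced_relabel
      by (auto dest: inj_onD)
    ultimately show ?case using p' by simp
  qed
  then show "inj_on (relabel \<phi>) {p. reduced n S p}" by (auto intro: inj_onI)
  have "\<exists>p. reduced n S p \<and> relabel \<phi> p = p'" if "reduced n S' p'" for p'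
    using that
  proof (induction p')
    case (Cons s' p')
    then obtain p where p: "reduced n S p" "relabel \<phi> p = p'" by auto
    with Cons.prems obtain s where "step_ok n S p s" "relabel_step \<phi> p p' s = s'"
      using bij_betw_imp_surj_on[OF bij_betw_relabel_step[of p]] by auto (metis imageE mem_Collect_eq)
    then have "reduced n S (s # p) \<and> relabel \<phi> (s # p) = s' # p'" using p by simp
    then show ?case by blast
  qed (auto intro: exI[of _ "[]"])
  then show "relabel \<phi> ` {p. reduced n S p} = {p. reduced n S' p}"
    using reduced_relabel by blast
qed

lemma bij_betw_relabel_points:
  "bij_betw (map_prod (relabel \<phi>) id) (points n S q) (points n S' q)"
proof -
  have "inj_on (map_prod (relabel \<phi>) id) (points n S q)"
    using bij_betw_imp_inj_on[OF bij_betw_relabel] by (auto simp: points_def inj_on_def)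
  moreover have "map_prod (relabel \<phi>) id ` points n S q = points n S' q"
  proof
    show "map_prod (relabel \<phi>) id ` points n S q \<subseteq> points n S' q"
      using reduced_relabel by (auto simp: points_def)
    show "points n S' q \<subseteq> map_prod (relabel \<phi>) id ` points n S q"
    proof clarify
      fix p' m assume "(p', m) \<in> points n S' q"
      moreover from this obtain p where "reduced n S p" "p' = relabel \<phi> p"
        using bij_betw_imp_surj_on[OF bij_betw_relabel] by (auto simp: points_def)
      ultimately show "(p', m) \<in> map_prod (relabel \<phi>) id ` points n S q"
        by (intro image_eqI[of _ _ "(p, m)"]) (auto simp: points_def)
    qed
  qed
  ultimately show ?thesis by (simp add: bij_betw_def)
qed

text \<open>A crossing labeled \<alpha> corresponds to one with the fitted label, and the fitting
  depends on the path. Taking all labels at once removes this dependence, because the fitted maps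
  are onto.\<close>

lemma crossings_relabel:
  assumes v: "v \<in> points n S q"
  shows "crossings n S' (map_prod (relabel \<phi>) id v) = map_prod (relabel \<phi>) id ` crossings n S v"
proof -
  obtain p m where pm: "v = (p, m)" by force
  have p: "reduced n S p" "reduced n S' (relabel \<phi> p)" using v reduced_relabel by (auto simp: points_def pm)
  let ?F = "map_prod (relabel \<phi>) id"
  let ?i = "fit (\<phi> (even (length p))) (in_label p) (in_label (relabel \<phi> p))"
  let ?o = "fit (\<phi> (odd (length p))) (out_label p) (out_label (relabel \<phi> p))"
  note i = fit_in[OF p] and o = fit_out[OF p]
  have "cross_out n (?i \<alpha>) (?F v) = ?F (cross_out n \<alpha> v)" if "\<alpha> \<in> S (even (length p))" for \<alpha>
    using i(2)[OF that] by (auto simp: pm in_label_eq_Some)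
  then have "(\<lambda>\<alpha>. cross_out n \<alpha> (?F v)) ` ?i ` S (even (length p)) =
      ?F ` (\<lambda>\<alpha>. cross_out n \<alpha> v) ` S (even (length p))"
    by (auto simp: image_image intro!: image_cong)
  moreover have "cross_in n (?o \<alpha>) (?F v) = ?F (cross_in n \<alpha> v)" if "\<alpha> \<in> S (odd (length p))" for \<alpha>
    using o(2)[OF that] by (auto simp: pm cross_in_eq_if out_label_eq_Some)
  then have "(\<lambda>\<alpha>. cross_in n \<alpha> (?F v)) ` ?o ` S (odd (length p)) =
      ?F ` (\<lambda>\<alpha>. cross_in n \<alpha> v) ` S (odd (length p))"
    by (auto simp: image_image intro!: image_cong)
  ultimately show ?thesis
    unfolding bij_betw_imp_surj_on[OF i(1)] bij_betw_imp_surj_on[OF o(1)]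
    by (simp add: crossings_def pm image_Un Let_def del: cross_out.simps cross_in.simps)
qed

lemma nearby_relabel:
  assumes v: "v \<in> points n S q"
  shows "nearby n S' (map_prod (relabel \<phi>) id v) = map_prod (relabel \<phi>) id ` nearby n S v"
proof -
  have F: "map_prod (relabel \<phi>) id (shift c u) = shift c (map_prod (relabel \<phi>) id u)" for c u
    by (cases u) (simp add: shift_def)
  have "shift d v \<in> points n S q" for d using v by simp
  note crossings_relabel[OF this]
  then have "shift c ` crossings n S' (shift d (map_prod (relabel \<phi>) id v)) =
      map_prod (relabel \<phi>) id ` shift c ` crossings n S (shift d v)" for c d
    by (simp add: F image_image flip: F)
  then show ?thesis by (simp only: nearby_def image_UN)
qed

end

subsection \<open>The group of a two-vertex graph acting on points\<close>

text \<open>Well-definedness of an action of a presented group: it is enough that the two signs of a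
  generator act as mutually inverse maps and that the relations hold. As \<open>fold\<close> reads
  words from the left, this is a right action.\<close>

lemma word_eq_fold:
  assumes "word_eq X R w w'" "v \<in> V"
    and V: "\<And>x b v. x \<in> X \<Longrightarrow> v \<in> V \<Longrightarrow> \<rho> (x, b) v \<in> V"
    and inv: "\<And>x b v. x \<in> X \<Longrightarrow> v \<in> V \<Longrightarrow> \<rho> (x, \<not> b) (\<rho> (x, b) v) = v"
    and rel: "\<And>l r v. (l, r) \<in> R \<Longrightarrow> v \<in> V \<Longrightarrow> fold \<rho> l v = fold \<rho> r v"
  shows "fold \<rho> w v = fold \<rho> w' v"
proof -
  have fold_V: "fold \<rho> p v \<in> V" if "p \<in> words X" "v \<in> V" for p v
    using that by (induction p arbitrary: v) (auto intro: V)
  from assms(1,2) show ?thesis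
  proof (induction arbitrary: v rule: word_eq.induct)
    case (cancel p q x b)
    then show ?case using inv fold_V by simp
  next
    case (relation p q l r)
    then show ?case using rel fold_V by simp
  qed auto
qed

section \<open>Classes of words as group elements\<close>

definition word_class :: "'x set \<Rightarrow> ('x word \<times> 'x word) set \<Rightarrow> 'x word \<Rightarrow> 'x word set" where
  "word_class X R w = word_rel X R `` {w}"

lemma carrier_presented_group: "carrier (presented_group X R) = word_class X R ` words X"
  by (auto simp: presented_group_def quotient_def word_class_def)

lemma word_class_eq: "word_eq X R w w' \<Longrightarrow> word_class X R w = word_class X R w'"
  unfolding word_class_def by (intro equiv_class_eq[OF equiv_word_rel]) (simp add: word_rel_def)

lemma word_class_eq_iff:
  "w \<in> words X \<Longrightarrow> w' \<in> words X \<Longrightarrow> word_class X R w = word_class X R w' \<longleftrightarrow> word_eq X R w w'"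
  unfolding word_class_def by (subst eq_equiv_class_iff[OF equiv_word_rel]) (simp_all add: word_rel_def)

lemma word_class_append:
  "v \<in> words X \<Longrightarrow> w \<in> words X \<Longrightarrow>
    word_class X R (v @ w) = word_class X R v \<otimes>\<^bsub>presented_group X R\<^esub> word_class X R w"
  by (simp add: word_class_def mult_presented_group)

lemma word_class_Nil: "word_class X R [] = \<one>\<^bsub>presented_group X R\<^esub>"
  by (simp add: word_class_def presented_group_def)

section \<open>Strips over the edges of a two-vertex graph\<close>

locale two_vertex_labels =
  fixes n :: int and ls :: "(int \<times> int) list"
  assumes n: "n > 1" and ls: "ls \<noteq> []"
    and labels: "\<And>x y. (x, y) \<in> set ls \<Longrightarrow> 0 < x \<and> 0 < y \<and> (x = n * y \<or> y = n * x)"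
begin

definition lab :: "bool \<Rightarrow> nat \<Rightarrow> int" where
  "lab q e = (if q then fst (ls ! e) else snd (ls ! e))"

definition out :: "bool \<Rightarrow> nat \<Rightarrow> bool" where
  "out q e \<longleftrightarrow> lab q e = n * lab (\<not> q) e"

text \<open>The number of cells of the annulus of \<open>e\<close>. On the side of parity
  \<open>q\<close> each cell meets \<open>width q e\<close> unit intervals, whence
  \<open>lab q e\<close> is the product of the two (\<open>lab_eq\<close>).\<close>

definition period :: "nat \<Rightarrow> int" where
  "period e = min (lab True e) (lab False e)"

definition width :: "bool \<Rightarrow> nat \<Rightarrow> int" where
  "width q e = (if out q e then n else 1)"

definition strips :: "bool \<Rightarrow> (nat \<times> int) set" where
  "strips q = {(e, i). e < length ls \<and> out q e \<and> 0 \<le> i \<and> i < period e}"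

lemma lab_pos: "e < length ls \<Longrightarrow> lab q e > 0"
  and lab_cases: "e < length ls \<Longrightarrow> lab True e = n * lab False e \<or> lab False e = n * lab True e"
  using labels[of "fst (ls ! e)" "snd (ls ! e)"] by (auto simp: lab_def)

lemma period_pos: "e < length ls \<Longrightarrow> period e > 0"
  by (simp add: period_def lab_pos)

lemma less_mult: "(0::int) < a \<Longrightarrow> a < n * a"
  using n by simp

lemma out_not:
  assumes "e < length ls"
  shows "out (\<not> q) e \<longleftrightarrow> \<not> out q e"
proof -
  have "\<not> (out True e \<and> out False e)"
    using less_mult[OF lab_pos[OF assms, of True]] less_mult[OF lab_pos[OF assms, of False]]
    unfolding out_def not_True_eq_False not_False_eq_True by linarith
  moreover have "out True e \<or> out False e" using lab_cases[OF assms] by (simp add: out_def)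
  ultimately show ?thesis by (cases q) auto
qed

lemma lab_eq: "e < length ls \<Longrightarrow> lab q e = width q e * period e"
  using less_mult[OF lab_pos[of e True]] less_mult[OF lab_pos[of e False]] lab_cases[of e] out_not[of e q]
  by (cases q) (auto simp: width_def period_def out_def min_def)

abbreviation pts :: "bool \<Rightarrow> (nat \<times> int) point set" where
  "pts q \<equiv> points n strips q"

text \<open>The offset is the number of the cell at which the point sits, modulo
  \<open>period e\<close>. Among the lifts of \<open>e\<close> at this point it singles out the one
  whose crossing is right multiplication by the stable letter (\<open>ev_cross\<close>).\<close>

definition cross :: "bool \<Rightarrow> nat \<Rightarrow> (nat \<times> int) point \<Rightarrow> (nat \<times> int) point" where
  "cross q e v = (if out q e then cross_out n (e, (snd v div n) mod period e) v
    else cross_in n (e, snd v mod period e) v)"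

lemma cross_points:
  assumes "e < length ls" "v \<in> pts q"
  shows "cross q e v \<in> pts (\<not> q)"
  using assms n period_pos[OF assms(1)] out_not[OF assms(1), of q]
  by (auto simp: cross_def strips_def intro!: cross_out_points cross_in_points)

text \<open>Both directions choose the same offset: the cell number is the position on the side of
  width 1 and the position divided by \<open>n\<close> on the other.\<close>

lemma cross_cross:
  assumes "e < length ls" "v \<in> pts q"
  shows "cross (\<not> q) e (cross q e v) = v"
proof -
  have "n > 0" using n by simp
  note this assms(2)
  note simps = cross_in_cross_out[OF this] cross_out_cross_in[OF this] snd_cross_in_div[OF this]
  show ?thesis
    using out_not[OF assms(1), of q] simps by (auto simp: cross_def snd_cross_out)
qed

text \<open>The shift advances the cell number by a multiple of \<open>period e\<close>, so the
  chosen strip stays the same. This is the point version of the relation that \<open>e\<close>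
  imposes in the group.\<close>

lemma cross_shift:
  assumes "e < length ls"
  shows "cross q e (shift (lab q e * c) v) = shift (lab (\<not> q) e * c) (cross q e v)"
proof (cases "out q e")
  case True
  have "(snd v + n * (period e * c)) div n = snd v div n + period e * c" using n by simp
  then show ?thesis
    using True out_not[OF assms, of q] n cross_out_shift[of n _ "period e * c" v]
    by (simp add: cross_def lab_eq[OF assms] width_def mult.assoc) (simp add: shift_def)
next
  case False
  then show ?thesis
    using out_not[OF assms, of q] cross_in_shift[of n _ "period e * c" v]
    by (simp add: cross_def lab_eq[OF assms] width_def mult.assoc) (simp add: shift_def)
qed

section \<open>The right action on points over \<open>v\<close>\<close>

abbreviation gens :: "(two_vertices, nat, int) gog_gen set" where
  "gens \<equiv> pi1_gens (gog_of_labeled_graph (two_vertex_graph ls))"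

abbreviation rels where
  "rels \<equiv> pi1_rels (gog_of_labeled_graph (two_vertex_graph ls)) {0}"

abbreviation G where "G \<equiv> two_vertex_group ls"

lemma G_eq: "G = presented_group gens rels"
  by (simp add: two_vertex_group_def labeled_graph_group_def pi1_def)

sublocale group G by (rule group_two_vertex_group)

definition vert :: "bool \<Rightarrow> two_vertices" where "vert q = (if q then vertex_v else vertex_u)"

lemma two_vertices_exhaust: "w = vertex_v \<or> w = vertex_u"
  by (cases w) auto

lemma mem_gens [simp]: "Vertex_elem w m \<in> gens" "Stable_letter e \<in> gens \<longleftrightarrow> e < length ls"
  using two_vertices_exhaust[of w]
  by (auto simp: pi1_gens_def gog_of_labeled_graph_def two_vertex_graph_def)

lemma mem_rels:
  "(l, r) \<in> rels \<longleftrightarrow>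
    (\<exists>w c d. l = [(Vertex_elem w c, True), (Vertex_elem w d, True)] \<and> r = [(Vertex_elem w (c + d), True)]) \<or>
    (\<exists>e c. e < length ls \<and>
      l = [(Stable_letter e, True), (Vertex_elem vertex_u (lab False e * c), True), (Stable_letter e, False)] \<and>
      r = [(Vertex_elem vertex_v (lab True e * c), True)]) \<or>
    l = [(Stable_letter 0, True)] \<and> r = []"
proof -
  have "w \<in> {vertex_v, vertex_u}" for w using two_vertices_exhaust by blast
  then show ?thesis
    by (auto simp: pi1_rels_def gog_of_labeled_graph_def two_vertex_graph_def lab_def)
qed

text \<open>
  The right action of words on the points over \<open>v\<close>. As edge \<open>0\<close> is the maximal tree, the generators
  at \<open>u\<close> act after crossing edge \<open>0\<close>, and a stable letter crosses its edge and returns along edge \<open>0\<close>.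
\<close>

fun act :: "(two_vertices, nat, int) gog_gen \<times> bool \<Rightarrow> (nat \<times> int) point \<Rightarrow> (nat \<times> int) point" where
  "act (Vertex_elem vertex_v c, b) v = shift (if b then c else - c) v"
| "act (Vertex_elem vertex_u c, b) v = cross False 0 (shift (if b then c else - c) (cross True 0 v))"
| "act (Stable_letter e, b) v = (if b then cross False 0 (cross True e v) else cross False e (cross True 0 v))"

lemma cross_cross_simps [simp]:
  assumes "e < length ls"
  shows "v \<in> pts True \<Longrightarrow> cross True e v \<in> pts False" "v \<in> pts False \<Longrightarrow> cross False e v \<in> pts True"
    "v \<in> pts True \<Longrightarrow> cross False e (cross True e v) = v" "v \<in> pts False \<Longrightarrow> cross True e (cross False e v) = v"
  using cross_points[OF assms, of v True] cross_points[OF assms, of v False]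
    cross_cross[OF assms, of v True] cross_cross[OF assms, of v False] by auto

lemma zero_less_length [simp]: "0 < length ls" using ls by simp

lemma act_points: "x \<in> gens \<Longrightarrow> v \<in> pts True \<Longrightarrow> act (x, b) v \<in> pts True"
  by (cases "((x, b), v)" rule: act.cases) (auto simp del: length_greater_0_conv)

lemma act_inverse: "x \<in> gens \<Longrightarrow> v \<in> pts True \<Longrightarrow> act (x, \<not> b) (act (x, b) v) = v"
  by (cases "((x, b), v)" rule: act.cases) (auto simp del: length_greater_0_conv)

lemma act_relation:
  assumes "(l, r) \<in> rels" "v \<in> pts True"
  shows "fold act l v = fold act r v"
proof -
  consider (vert) w c d where "l = [(Vertex_elem w c, True), (Vertex_elem w d, True)]"
      "r = [(Vertex_elem w (c + d), True)]"
    | (edge) e c where "e < length ls"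
      "l = [(Stable_letter e, True), (Vertex_elem vertex_u (lab False e * c), True), (Stable_letter e, False)]"
      "r = [(Vertex_elem vertex_v (lab True e * c), True)]"
    | (tree) "l = [(Stable_letter 0, True)]" "r = []"
    using assms(1) unfolding mem_rels by blast
  then show ?thesis
  proof cases
    case vert
    then show ?thesis using assms(2) by (cases w) (simp_all del: length_greater_0_conv)
  next
    case edge
    have "cross True e (shift (lab True e * c) v) = shift (lab False e * c) (cross True e v)"
      using cross_shift[OF edge(1), of True] by simp
    then have "cross False e (shift (lab False e * c) (cross True e v)) = shift (lab True e * c) v"
      using edge(1) assms(2) by (metis cross_cross_simps(3) shift_points)
    then show ?thesis using assms(2) edge by (simp del: length_greater_0_conv)
  next
    case tree
    then show ?thesis using assms(2) by (simp del: length_greater_0_conv)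
  qed
qed

lemma fold_act_cong: "word_eq gens rels w w' \<Longrightarrow> v \<in> pts True \<Longrightarrow> fold act w v = fold act w' v"
  using word_eq_fold[of gens rels w w' v "pts True" act] act_points act_inverse act_relation by blast

lemma fold_act_points: "w \<in> words gens \<Longrightarrow> v \<in> pts True \<Longrightarrow> fold act w v \<in> pts True"
proof (induction w arbitrary: v)
  case (Cons s w)
  then show ?case using act_points[of "fst s" v "snd s"] by (cases s) simp
qed simp

section \<open>Group elements attached to vertices, edges and strips\<close>

abbreviation cls where "cls \<equiv> word_class gens rels"

definition \<gamma> :: "bool \<Rightarrow> int \<Rightarrow> (two_vertices, nat, int) gog_gen word set" where
  "\<gamma> q c = cls [(Vertex_elem (vert q) c, True)]"

text \<open>The flag is the parity of the side from which \<open>e\<close> is crossed: the stable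
  letter itself from \<open>v\<close>, its inverse from \<open>u\<close>.\<close>

definition \<theta> :: "bool \<Rightarrow> nat \<Rightarrow> (two_vertices, nat, int) gog_gen word set" where
  "\<theta> q e = cls [(Stable_letter e, q)]"

lemma cls_append: "v \<in> words gens \<Longrightarrow> w \<in> words gens \<Longrightarrow> cls (v @ w) = cls v \<otimes>\<^bsub>G\<^esub> cls w"
  by (simp add: G_eq word_class_append)

lemma cls_Cons: "x \<in> gens \<Longrightarrow> w \<in> words gens \<Longrightarrow> cls ((x, b) # w) = cls [(x, b)] \<otimes>\<^bsub>G\<^esub> cls w"
  using cls_append[of "[(x, b)]" w] by simp

lemma cls_Cons_Cons:
  "x \<in> gens \<Longrightarrow> s # w \<in> words gens \<Longrightarrow> cls ((x, b) # s # w) = cls [(x, b)] \<otimes>\<^bsub>G\<^esub> cls (s # w)"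
  by (rule cls_Cons)

lemma cls_closed: "w \<in> words gens \<Longrightarrow> cls w \<in> carrier G"
  by (simp add: G_eq carrier_presented_group)

lemma cls_relation: "(l, r) \<in> rels \<Longrightarrow> l \<in> words gens \<Longrightarrow> r \<in> words gens \<Longrightarrow> cls l = cls r"
  using word_eq.relation[of "[]" gens "[]" l r rels] by (intro word_class_eq) simp

lemma \<gamma>_closed [simp]: "\<gamma> q c \<in> carrier G"
  by (simp add: \<gamma>_def cls_closed)

lemma \<theta>_closed [simp]: "e < length ls \<Longrightarrow> \<theta> q e \<in> carrier G"
  by (simp add: \<theta>_def cls_closed)

lemma \<gamma>_add: "\<gamma> q c \<otimes>\<^bsub>G\<^esub> \<gamma> q d = \<gamma> q (c + d)"
  unfolding \<gamma>_def by (subst cls_Cons[symmetric], simp, simp, rule cls_relation) (auto simp: mem_rels)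

lemma \<gamma>_0 [simp]: "\<gamma> q 0 = \<one>\<^bsub>G\<^esub>"
  using \<gamma>_add[of q 0 0] by simp

lemma cls_inverse: "x \<in> gens \<Longrightarrow> cls [(x, b)] \<otimes>\<^bsub>G\<^esub> cls [(x, \<not> b)] = \<one>\<^bsub>G\<^esub>"
  using word_class_eq[OF word_eq.cancel[of "[]" gens "[]" x rels b]]
  by (simp flip: cls_Cons add: word_class_Nil) (simp add: G_eq word_class_Nil)

lemma cls_Vertex_elem: "cls [(Vertex_elem (vert q) c, b)] = \<gamma> q (if b then c else - c)"
proof (cases b)
  case False
  have "\<gamma> q c \<otimes>\<^bsub>G\<^esub> cls [(Vertex_elem (vert q) c, False)] = \<gamma> q c \<otimes>\<^bsub>G\<^esub> \<gamma> q (- c)"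
    using cls_inverse[of "Vertex_elem (vert q) c" True] by (simp add: \<gamma>_add flip: \<gamma>_def)
  then show ?thesis using False by (simp add: cls_closed)
qed (simp add: \<gamma>_def)

lemma \<theta>_\<theta>: "e < length ls \<Longrightarrow> \<theta> q e \<otimes>\<^bsub>G\<^esub> \<theta> (\<not> q) e = \<one>\<^bsub>G\<^esub>"
  unfolding \<theta>_def by (rule cls_inverse) simp

lemma \<theta>_0 [simp]: "\<theta> q 0 = \<one>\<^bsub>G\<^esub>"
proof -
  have "\<theta> True 0 = \<one>\<^bsub>G\<^esub>"
    unfolding \<theta>_def by (subst cls_relation[of _ "[]"]) (auto simp: mem_rels G_eq word_class_Nil ls)
  then show ?thesis using \<theta>_\<theta>[of 0 q] by (cases q) (auto simp del: length_greater_0_conv)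
qed

lemma \<gamma>_\<theta>:
  assumes e: "e < length ls"
  shows "\<gamma> q (lab q e * c) \<otimes>\<^bsub>G\<^esub> \<theta> q e = \<theta> q e \<otimes>\<^bsub>G\<^esub> \<gamma> (\<not> q) (lab (\<not> q) e * c)"
proof -
  have rel: "([(Stable_letter e, True), (Vertex_elem vertex_u (lab False e * c), True), (Stable_letter e, False)],
      [(Vertex_elem vertex_v (lab True e * c), True)]) \<in> rels"
    unfolding mem_rels using e by blast
  have main: "\<theta> True e \<otimes>\<^bsub>G\<^esub> (\<gamma> False (lab False e * c) \<otimes>\<^bsub>G\<^esub> \<theta> False e) = \<gamma> True (lab True e * c)"
    using cls_relation[OF rel] e by (simp add: cls_Cons_Cons \<theta>_def \<gamma>_def vert_def)
  have "\<gamma> True (lab True e * c) \<otimes>\<^bsub>G\<^esub> \<theta> True e = \<theta> True e \<otimes>\<^bsub>G\<^esub> (\<gamma> False (lab False e * c) \<otimes>\<^bsub>G\<^esub> (\<theta> False e \<otimes>\<^bsub>G\<^esub> \<theta> True e))"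
    using e by (simp add: m_assoc flip: main)
  then have "\<gamma> True (lab True e * c) \<otimes>\<^bsub>G\<^esub> \<theta> True e = \<theta> True e \<otimes>\<^bsub>G\<^esub> \<gamma> False (lab False e * c)" using \<theta>_\<theta>[OF e, of False] e by simp
  moreover have "\<theta> False e \<otimes>\<^bsub>G\<^esub> \<gamma> True (lab True e * c) = (\<theta> False e \<otimes>\<^bsub>G\<^esub> \<theta> True e) \<otimes>\<^bsub>G\<^esub> (\<gamma> False (lab False e * c) \<otimes>\<^bsub>G\<^esub> \<theta> False e)"
    using e by (simp add: m_assoc flip: main)
  then have "\<theta> False e \<otimes>\<^bsub>G\<^esub> \<gamma> True (lab True e * c) = \<gamma> False (lab False e * c) \<otimes>\<^bsub>G\<^esub> \<theta> False e" using \<theta>_\<theta>[OF e, of False] e by simp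
  ultimately show ?thesis by (cases q) simp_all
qed

text \<open>
  Crossing a lift of \<open>e\<close> from a point of parity \<open>q\<close> is right multiplication by one of these elements
  (see \<open>ev_crossings\<close>), of which there are finitely many by periodicity in \<open>l\<close>.
\<close>

definition core :: "bool \<Rightarrow> nat \<Rightarrow> int \<Rightarrow> (two_vertices, nat, int) gog_gen word set" where
  "core q e l = \<gamma> q (width q e * l) \<otimes>\<^bsub>G\<^esub> \<theta> q e \<otimes>\<^bsub>G\<^esub> \<gamma> (\<not> q) (- (width (\<not> q) e * l))"

lemma core_closed [simp]: "e < length ls \<Longrightarrow> core q e l \<in> carrier G"
  by (simp add: core_def)

text \<open>Sliding along a strip by \<open>c\<close> cells: the positions on the two sides change
  by the respective widths, and the offset changes by \<open>c\<close>.\<close>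

lemma \<gamma>_core:
  assumes "e < length ls"
  shows "\<gamma> q (width q e * c) \<otimes>\<^bsub>G\<^esub> core q e l = core q e (c + l) \<otimes>\<^bsub>G\<^esub> \<gamma> (\<not> q) (width (\<not> q) e * c)"
proof -
  have "\<gamma> q (width q e * c) \<otimes>\<^bsub>G\<^esub> core q e l =
      (\<gamma> q (width q e * c) \<otimes>\<^bsub>G\<^esub> \<gamma> q (width q e * l)) \<otimes>\<^bsub>G\<^esub> \<theta> q e \<otimes>\<^bsub>G\<^esub> \<gamma> (\<not> q) (- (width (\<not> q) e * l))"
    using assms by (simp add: core_def m_assoc)
  also have "\<dots> = \<gamma> q (width q e * (c + l)) \<otimes>\<^bsub>G\<^esub> \<theta> q e \<otimes>\<^bsub>G\<^esub>
      (\<gamma> (\<not> q) (- (width (\<not> q) e * (c + l))) \<otimes>\<^bsub>G\<^esub> \<gamma> (\<not> q) (width (\<not> q) e * c))"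
    by (simp add: \<gamma>_add algebra_simps)
  also have "\<dots> = core q e (c + l) \<otimes>\<^bsub>G\<^esub> \<gamma> (\<not> q) (width (\<not> q) e * c)"
    using assms by (simp add: core_def m_assoc)
  finally show ?thesis .
qed

lemma core_core:
  assumes "e < length ls"
  shows "core q e l \<otimes>\<^bsub>G\<^esub> core (\<not> q) e l = \<one>\<^bsub>G\<^esub>"
proof -
  have "core q e l \<otimes>\<^bsub>G\<^esub> core (\<not> q) e l = \<gamma> q (width q e * l) \<otimes>\<^bsub>G\<^esub> (\<theta> q e \<otimes>\<^bsub>G\<^esub>
      ((\<gamma> (\<not> q) (- (width (\<not> q) e * l)) \<otimes>\<^bsub>G\<^esub> \<gamma> (\<not> q) (width (\<not> q) e * l)) \<otimes>\<^bsub>G\<^esub>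
        \<theta> (\<not> q) e)) \<otimes>\<^bsub>G\<^esub> \<gamma> q (- (width q e * l))"
    using assms by (simp add: core_def m_assoc)
  also have "\<dots> = \<one>\<^bsub>G\<^esub>" using assms by (simp add: \<gamma>_add \<theta>_\<theta>)
  finally show ?thesis .
qed

lemma core_0: "e < length ls \<Longrightarrow> core q e 0 = \<theta> q e"
  by (simp add: core_def)

text \<open>For \<open>l = 0\<close> this is the edge relation, compared with sliding by
  \<open>period e * c\<close> cells; a further slide by \<open>l\<close> cells carries it to every
  offset.\<close>

lemma core_periodic:
  assumes "e < length ls"
  shows "core q e (period e * c + l) = core q e l"
proof -
  have "core q e 0 \<otimes>\<^bsub>G\<^esub> \<gamma> (\<not> q) (lab (\<not> q) e * c) = core q e (period e * c) \<otimes>\<^bsub>G\<^esub> \<gamma> (\<not> q) (lab (\<not> q) e * c)"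
    using \<gamma>_core[OF assms, of q "period e * c" 0] \<gamma>_\<theta>[OF assms, of q c] assms
    by (simp add: lab_eq mult.assoc core_0)
  then have 0: "core q e (period e * c) = core q e 0" using assms by simp
  have "core q e (l + period e * c) \<otimes>\<^bsub>G\<^esub> \<gamma> (\<not> q) (width (\<not> q) e * l) =
      core q e (l + 0) \<otimes>\<^bsub>G\<^esub> \<gamma> (\<not> q) (width (\<not> q) e * l)"
    using \<gamma>_core[OF assms, of q l "period e * c"] \<gamma>_core[OF assms, of q l 0] 0 by simp
  then show ?thesis using assms by (simp add: add.commute)
qed

text \<open>Up to a translation of the line reached, these are the products
  \<open>\<gamma> q c\<close> times \<open>\<theta> q e\<close> with \<open>c\<close> running
  through representatives modulo \<open>lab q e\<close>: \<open>r + n * i\<close> for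
  \<open>Out\<close> and \<open>i\<close> for \<open>In\<close>. They are the usual coset
  representatives of Bass-Serre normal forms.\<close>

fun step_value :: "bool \<Rightarrow> (nat \<times> int) step \<Rightarrow> (two_vertices, nat, int) gog_gen word set" where
  "step_value q (Out r (e, i)) = \<gamma> q r \<otimes>\<^bsub>G\<^esub> core q e i"
| "step_value q (In (e, i)) = core q e i"

primrec path_value :: "(nat \<times> int) step list \<Rightarrow> (two_vertices, nat, int) gog_gen word set" where
  "path_value [] = \<one>\<^bsub>G\<^esub>"
| "path_value (s # p) = path_value p \<otimes>\<^bsub>G\<^esub> step_value (even (length p)) s"

definition ev :: "(nat \<times> int) point \<Rightarrow> (two_vertices, nat, int) gog_gen word set" where
  "ev v = path_value (fst v) \<otimes>\<^bsub>G\<^esub> \<gamma> (even (length (fst v))) (snd v)"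

lemma mem_strips [simp]: "(e, i) \<in> strips q \<longleftrightarrow> e < length ls \<and> out q e \<and> 0 \<le> i \<and> i < period e"
  by (simp add: strips_def)

lemma path_value_closed [simp]: "reduced n strips p \<Longrightarrow> path_value p \<in> carrier G"
proof (induction p)
  case (Cons s p)
  then show ?case by (cases "(True, s)" rule: step_value.cases) auto
qed simp

lemma ev_closed [simp]: "v \<in> pts q \<Longrightarrow> ev v \<in> carrier G"
  by (auto simp: points_def ev_def)

lemma ev_shift: "v \<in> pts q \<Longrightarrow> ev (shift c v) = ev v \<otimes>\<^bsub>G\<^esub> \<gamma> q c"
  by (auto simp: points_def ev_def shift_def m_assoc \<gamma>_add)

text \<open>The offset \<open>i\<close> is measured from the origin of the line; seen from a point
  in cell \<open>j\<close> it becomes \<open>i - j\<close>, by \<open>\<gamma>_core\<close>. In the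
  backtracking case the two strip elements cancel by \<open>core_core\<close>.\<close>

lemma ev_cross_out:
  assumes v: "v \<in> pts q" and i: "(e, i) \<in> strips q"
  shows "ev (cross_out n (e, i) v) = ev v \<otimes>\<^bsub>G\<^esub> core q e (i - snd v div n)"
proof -
  obtain p m where pm: "v = (p, m)" by force
  have p: "reduced n strips p" "even (length p) = q" using v by (auto simp: points_def pm)
  have e: "e < length ls" using i by simp
  have w: "width q e = n" "width (\<not> q) e = 1" using i out_not[OF e, of q] by (auto simp: width_def)
  define j where "j = m div n"
  have core: "\<gamma> q (n * j) \<otimes>\<^bsub>G\<^esub> core q e (i - j) = core q e i \<otimes>\<^bsub>G\<^esub> \<gamma> (\<not> q) j"
    using \<gamma>_core[OF e, of q j "i - j"] w by simp
  show ?thesis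
  proof (cases "m mod n = 0 \<and> in_label p = Some (e, i)")
    case True
    then obtain p' where p': "p = In (e, i) # p'" by (auto simp: in_label_eq_Some)
    have m: "m = n * j" using True by (auto simp: j_def)
    have q: "even (length p') = (\<not> q)" "reduced n strips p'" using p p' by auto
    have "ev v \<otimes>\<^bsub>G\<^esub> core q e (i - j) = path_value p' \<otimes>\<^bsub>G\<^esub> core (\<not> q) e i \<otimes>\<^bsub>G\<^esub> (core q e i \<otimes>\<^bsub>G\<^esub> \<gamma> (\<not> q) j)"
      using e q by (simp add: ev_def pm p' m_assoc flip: core m)
    also have "\<dots> = path_value p' \<otimes>\<^bsub>G\<^esub> (core (\<not> q) e i \<otimes>\<^bsub>G\<^esub> core q e i) \<otimes>\<^bsub>G\<^esub> \<gamma> (\<not> q) j"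
      using e q by (simp add: m_assoc)
    also have "\<dots> = path_value p' \<otimes>\<^bsub>G\<^esub> \<gamma> (\<not> q) j"
      using e q core_core[OF e, of "\<not> q"] by simp
    finally show ?thesis using True q by (simp add: ev_def pm p' j_def)
  next
    case False
    have "ev v \<otimes>\<^bsub>G\<^esub> core q e (i - j) = path_value p \<otimes>\<^bsub>G\<^esub> \<gamma> q (m mod n + n * j) \<otimes>\<^bsub>G\<^esub> core q e (i - j)"
      using p by (simp add: ev_def pm j_def)
    also have "\<dots> = path_value p \<otimes>\<^bsub>G\<^esub> \<gamma> q (m mod n) \<otimes>\<^bsub>G\<^esub> (\<gamma> q (n * j) \<otimes>\<^bsub>G\<^esub> core q e (i - j))"
      using p e by (simp add: m_assoc flip: \<gamma>_add)
    finally show ?thesis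
      using False p e by (auto simp: core ev_def pm m_assoc simp flip: j_def)
  qed
qed

lemma ev_cross_in:
  assumes v: "v \<in> pts q" and i: "(e, i) \<in> strips (\<not> q)"
  shows "ev (cross_in n (e, i) v) = ev v \<otimes>\<^bsub>G\<^esub> core q e (i - snd v)"
proof -
  obtain p j where pm: "v = (p, j)" by force
  have p: "reduced n strips p" "even (length p) = q" using v by (auto simp: points_def pm)
  have e: "e < length ls" using i by simp
  have w: "width q e = 1" "width (\<not> q) e = n" using i out_not[OF e, of q] by (auto simp: width_def)
  have core: "\<gamma> q j \<otimes>\<^bsub>G\<^esub> core q e (i - j) = core q e i \<otimes>\<^bsub>G\<^esub> \<gamma> (\<not> q) (n * j)"
    using \<gamma>_core[OF e, of q j "i - j"] w by simp
  show ?thesis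
  proof (cases "out_label p = Some (e, i)")
    case True
    then obtain r p' where p': "p = Out r (e, i) # p'" by (auto simp: out_label_eq_Some)
    have q: "even (length p') = (\<not> q)" "reduced n strips p'" using p p' by auto
    have "ev v \<otimes>\<^bsub>G\<^esub> core q e (i - j) =
        path_value p' \<otimes>\<^bsub>G\<^esub> \<gamma> (\<not> q) r \<otimes>\<^bsub>G\<^esub> core (\<not> q) e i \<otimes>\<^bsub>G\<^esub> (core q e i \<otimes>\<^bsub>G\<^esub> \<gamma> (\<not> q) (n * j))"
      using e q by (simp add: ev_def pm p' m_assoc flip: core)
    also have "\<dots> = path_value p' \<otimes>\<^bsub>G\<^esub> \<gamma> (\<not> q) r \<otimes>\<^bsub>G\<^esub>
        (core (\<not> q) e i \<otimes>\<^bsub>G\<^esub> core q e i) \<otimes>\<^bsub>G\<^esub> \<gamma> (\<not> q) (n * j)"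
      using e q by (simp add: m_assoc)
    also have "\<dots> = path_value p' \<otimes>\<^bsub>G\<^esub> \<gamma> (\<not> q) (r + n * j)"
      using e q core_core[OF e, of "\<not> q"] by (simp add: m_assoc \<gamma>_add)
    finally show ?thesis using q by (simp add: ev_def pm p')
  next
    case False
    then show ?thesis
      using p e by (simp add: cross_in_eq_if core ev_def pm m_assoc)
  qed
qed

lemma ev_cross:
  assumes "e < length ls" "v \<in> pts q"
  shows "ev (cross q e v) = ev v \<otimes>\<^bsub>G\<^esub> \<theta> q e"
proof -
  have *: "core q e (j mod period e - j) = \<theta> q e" for j
  proof -
    have "j mod period e - j = period e * - (j div period e) + 0"
      using mult_div_mod_eq[of "period e" j] by (simp add: algebra_simps)
    then show ?thesis using core_periodic[OF assms(1), of q "- (j div period e)" 0] core_0[OF assms(1)] by metis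
  qed
  show ?thesis
    using assms out_not[OF assms(1), of q] period_pos[OF assms(1)]
    by (simp add: cross_def ev_cross_out[OF assms(2)] ev_cross_in[OF assms(2)] *)
qed

lemma ev_act:
  assumes "x \<in> gens" "v \<in> pts True"
  shows "ev (act (x, b) v) = ev v \<otimes>\<^bsub>G\<^esub> cls [(x, b)]"
proof -
  consider (vert) c where "x = Vertex_elem vertex_v c" | (vert') c where "x = Vertex_elem vertex_u c"
    | (edge) e where "x = Stable_letter e" "e < length ls"
    using assms(1) two_vertices_exhaust by (cases x) auto
  then show ?thesis
  proof cases
    case vert
    then show ?thesis using assms cls_Vertex_elem[of True _ b] by (simp add: ev_shift vert_def)
  next
    case vert'
    have "cross True 0 v \<in> pts False" using cross_cross_simps(1)[OF zero_less_length] assms by blast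
    then show ?thesis
      using vert' assms cls_Vertex_elem[of False _ b]
      by (simp add: ev_cross[OF zero_less_length] ev_shift vert_def)
  next
    case edge
    then show ?thesis
      using assms cross_cross_simps(1)[OF edge(2)] cross_cross_simps(1)[OF zero_less_length]
      by (cases b) (simp_all add: ev_cross zero_less_length \<theta>_def[symmetric] del: length_greater_0_conv)
  qed
qed

lemma ev_fold_act:
  "w \<in> words gens \<Longrightarrow> v \<in> pts True \<Longrightarrow> ev (fold act w v) = ev v \<otimes>\<^bsub>G\<^esub> cls w"
proof (induction w arbitrary: v)
  case Nil
  then show ?case by (simp add: word_class_Nil flip: G_eq)
next
  case (Cons s w)
  obtain x b where s: "s = (x, b)" by force
  have x: "x \<in> gens" "w \<in> words gens" using Cons.prems s by auto
  then have "ev (fold act (s # w) v) = ev v \<otimes>\<^bsub>G\<^esub> cls [(x, b)] \<otimes>\<^bsub>G\<^esub> cls w"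
    using Cons act_points[of x v b] by (simp add: s ev_act del: act.simps)
  also have "\<dots> = ev v \<otimes>\<^bsub>G\<^esub> cls (s # w)"
    using x Cons.prems by (simp add: s cls_Cons[of x w] m_assoc cls_closed)
  finally show ?case .
qed

section \<open>Simple transitivity\<close>

definition base :: "(nat \<times> int) point" where "base = ([], 0)"

lemma base_points [simp]: "base \<in> pts True"
  by (simp add: base_def points_def)

lemma ev_base: "ev base = \<one>\<^bsub>G\<^esub>"
  by (simp add: base_def ev_def)

text \<open>The orbit of \<open>base\<close>, carried over to \<open>u\<close> across edge
  \<open>0\<close>. Having both parities lets the induction along a path alternate between the two
  sides.\<close>

definition reach :: "bool \<Rightarrow> (nat \<times> int) point set" where
  "reach q = (let A = (\<lambda>w. fold act w base) ` words gens in if q then A else cross True 0 ` A)"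

lemma reach_True: "reach True = (\<lambda>w. fold act w base) ` words gens"
  and reach_False: "reach False = cross True 0 ` reach True"
  by (simp_all add: reach_def)

lemma reach_points:
  assumes "v \<in> reach q"
  shows "v \<in> pts q"
proof -
  have "fold act w base \<in> pts True" if "w \<in> words gens" for w
    using that by (rule fold_act_points) simp
  then have "reach True \<subseteq> pts True" unfolding reach_True by (rule image_subsetI)
  moreover from this have "reach False \<subseteq> pts False"
    using cross_cross_simps(1)[OF zero_less_length] unfolding reach_False by blast
  ultimately show ?thesis using assms by (cases q) auto
qed

lemma reach_act: "v \<in> reach True \<Longrightarrow> x \<in> gens \<Longrightarrow> act (x, b) v \<in> reach True"
proof -
  assume "v \<in> reach True" "x \<in> gens"
  then obtain w where w: "w \<in> words gens" "v = fold act w base" by (auto simp: reach_True)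
  then have "act (x, b) v = fold act (w @ [(x, b)]) base" by simp
  moreover have "w @ [(x, b)] \<in> words gens" using w \<open>x \<in> gens\<close> by simp
  ultimately show ?thesis unfolding reach_True by blast
qed

lemma reach_shift:
  assumes "v \<in> reach q"
  shows "shift c v \<in> reach q"
proof (cases q)
  case True
  then show ?thesis using reach_act[of v "Vertex_elem vertex_v c" True] assms by simp
next
  case False
  then obtain u where u: "u \<in> reach True" "v = cross True 0 u" using assms by (auto simp: reach_False)
  have v: "v \<in> pts False" using reach_points[OF assms] False by simp
  have "cross False 0 (shift c v) \<in> reach True"
    using reach_act[OF u(1), of "Vertex_elem vertex_u c" True] u(2) by simp
  moreover have "shift c v = cross True 0 (cross False 0 (shift c v))"
    using v cross_cross_simps(4)[OF zero_less_length] by simp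
  ultimately have "shift c v \<in> reach False" unfolding reach_False by (rule rev_image_eqI)
  then show ?thesis using False by simp
qed

lemma reach_cross:
  assumes v: "v \<in> reach q" and e: "e < length ls"
  shows "cross q e v \<in> reach (\<not> q)"
proof (cases q)
  case True
  have "cross False 0 (cross True e v) \<in> reach True"
    using reach_act[of v "Stable_letter e" True] v e True by simp
  moreover have "cross True e v = cross True 0 (cross False 0 (cross True e v))"
    using reach_points[OF v] True cross_cross_simps(4)[OF zero_less_length] cross_cross_simps(1)[OF e] by simp
  ultimately have "cross True e v \<in> reach False" unfolding reach_False by (rule rev_image_eqI)
  then show ?thesis using True by simp
next
  case False
  then obtain u where "u \<in> reach True" "v = cross True 0 u" using v by (auto simp: reach_False)
  then have "cross False e v = act (Stable_letter e, False) u" "u \<in> reach True" by simp_all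
  then show ?thesis using reach_act[of u "Stable_letter e" False] e False by simp
qed

lemma points_reach: "(p, m) \<in> pts q \<Longrightarrow> (p, m) \<in> reach q"
proof (induction p arbitrary: m q)
  case Nil
  then have q: "q" by (simp add: points_def)
  have "base = fold act [] base" by simp
  then have "base \<in> reach True" unfolding reach_True by (metis image_eqI lists.Nil)
  then show ?case using q reach_shift[of base True m] by (simp add: base_def shift_def)
next
  case (Cons s p)
  have p: "reduced n strips p" "even (length p) = (\<not> q)" "step_ok n strips p s"
    using Cons.prems by (auto simp: points_def)
  have p': "(p, j) \<in> reach (\<not> q)" for j using p by (intro Cons.IH) (simp add: points_def)
  have "\<exists>j. (s # p, j) \<in> reach q"
  proof (cases s)
    case (Out r \<alpha>)
    obtain e i where \<alpha>: "\<alpha> = (e, i)" by force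
    have h: "e < length ls" "out (\<not> q) e" "0 \<le> i" "i < period e" "0 \<le> r" "r < n"
        "r = 0 \<longrightarrow> in_label p \<noteq> Some (e, i)"
      using p(2,3) by (auto simp: Out \<alpha>)
    \<comment> \<open>The position \<open>r + n * i\<close> has residue \<open>r\<close> and cell
      number \<open>i\<close>, so \<open>cross\<close> takes exactly the step
      \<open>Out r (e, i)\<close>; the condition from \<open>step_ok\<close> rules out
      cancellation.\<close>
    have "cross (\<not> q) e (p, r + n * i) = (s # p, i)"
      using h by (auto simp: cross_def Out \<alpha>)
    then show ?thesis using reach_cross[OF p' h(1)] by (metis (full_types))
  next
    case (In \<alpha>)
    obtain e i where \<alpha>: "\<alpha> = (e, i)" by force
    have h: "e < length ls" "\<not> out (\<not> q) e" "0 \<le> i" "i < period e" "out_label p \<noteq> Some (e, i)"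
      using p(2,3) out_not[of e q] by (auto simp: In \<alpha>)
    \<comment> \<open>On a side of width 1 the position is the cell number, so position
      \<open>i\<close> selects offset \<open>i\<close>.\<close>
    have "cross (\<not> q) e (p, i) = (s # p, n * i)"
      using h by (auto simp: cross_def In \<alpha> cross_in_eq_if)
    then show ?thesis using reach_cross[OF p' h(1)] by (metis (full_types))
  qed
  then obtain j where "(s # p, j) \<in> reach q" by blast
  then show ?case using reach_shift[of "(s # p, j)" q "m - j"] by (simp add: shift_def)
qed

text \<open>Every point over \<open>v\<close> is the image of \<open>base\<close> under some word,
  and its value is the class of that word. Points with equal values thus come from equal group
  elements, which act equally. Crossing edge \<open>0\<close> leaves values unchanged and transfers
  the result to \<open>u\<close>.\<close>

lemma bij_betw_ev: "bij_betw ev (pts q) (carrier G)"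
proof -
  have car: "carrier G = cls ` words gens" by (simp add: G_eq carrier_presented_group)
  have ev_w: "ev (fold act w base) = cls w" if "w \<in> words gens" for w
    using ev_fold_act[OF that base_points] that by (simp add: ev_base cls_closed)
  have inj: "inj_on ev (pts True)"
  proof (rule inj_onI)
    fix u v assume uv: "u \<in> pts True" "v \<in> pts True" "ev u = ev v"
    then obtain x y where xy: "x \<in> words gens" "u = fold act x base" "y \<in> words gens" "v = fold act y base"
      using points_reach by (metis (no_types, lifting) imageE reach_True surj_pair)
    then have "word_eq gens rels x y" using uv by (simp add: ev_w word_class_eq_iff)
    then show "u = v" using fold_act_cong[OF _ base_points] xy by blast
  qed
  have surj: "ev ` pts True = carrier G"
  proof
    show "carrier G \<subseteq> ev ` pts True"
      unfolding car using ev_w fold_act_points[OF _ base_points] by (metis image_subsetI rev_image_eqI)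
  qed auto
  have ev_0: "ev (cross True 0 v) = ev v" if "v \<in> pts True" for v
    using ev_cross[OF zero_less_length that] that by simp
  have pts: "pts False = cross True 0 ` pts True"
    using cross_cross_simps[OF zero_less_length] by (metis (no_types, lifting) image_subsetI rev_image_eqI subsetI subset_antisym)
  have "inj_on ev (pts False)"
    unfolding pts using inj by (auto simp: ev_0 inj_on_def)
  moreover have "ev ` pts False = carrier G"
    unfolding pts using surj by (simp add: image_image ev_0 cong: image_cong)
  ultimately show ?thesis using inj surj by (cases q) (auto simp: bij_betw_def)
qed

section \<open>Neighbours of a point as translates of a finite set\<close>

definition cores :: "(two_vertices, nat, int) gog_gen word set set" where
  "cores = {core True e l | e l. e < length ls \<and> 0 \<le> l \<and> l < period e}"

text \<open>The element belonging to a single label depends on the cell \<open>j e\<close> of the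
  point, but subtracting \<open>j e\<close> permutes the offsets modulo \<open>period e\<close>. The
  set of all these elements is therefore the same at every point.\<close>

lemma ev_crossings:
  assumes v: "v \<in> pts True"
  shows "ev ` crossings n strips v = (\<lambda>s. ev v \<otimes>\<^bsub>G\<^esub> s) ` cores"
proof -
  define j where "j e = (if out True e then snd v div n else snd v)" for e
  have "even (length (fst v))" using v by (auto simp: points_def)
  then have "ev ` crossings n strips v =
      (\<lambda>\<alpha>. ev (cross_out n \<alpha> v)) ` strips True \<union> (\<lambda>\<alpha>. ev (cross_in n \<alpha> v)) ` strips False"
    by (simp add: crossings_def image_Un image_image)
  also have "(\<lambda>\<alpha>. ev (cross_out n \<alpha> v)) ` strips True =
      (\<lambda>(e, i). ev v \<otimes>\<^bsub>G\<^esub> core True e (i - j e)) ` strips True"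
    using v by (intro image_cong) (auto simp: ev_cross_out j_def)
  also have "(\<lambda>\<alpha>. ev (cross_in n \<alpha> v)) ` strips False =
      (\<lambda>(e, i). ev v \<otimes>\<^bsub>G\<^esub> core True e (i - j e)) ` strips False"
    using v out_not[of _ True] by (intro image_cong) (auto simp: ev_cross_in j_def)
  also have "(\<lambda>(e, i). ev v \<otimes>\<^bsub>G\<^esub> core True e (i - j e)) ` strips True \<union>
      (\<lambda>(e, i). ev v \<otimes>\<^bsub>G\<^esub> core True e (i - j e)) ` strips False =
      (\<lambda>(e, i). ev v \<otimes>\<^bsub>G\<^esub> core True e (i - j e)) ` (SIGMA e:{..<length ls}. {0..<period e})"
    \<comment> \<open>Each edge is \<open>out\<close> for exactly one parity, so the two sets of
      strips together contain every edge with every offset.\<close>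
    using out_not[of _ True] by (simp flip: image_Un) (rule arg_cong[where f = "image _"], auto simp: strips_def)
  also have "\<dots> = (\<lambda>s. ev v \<otimes>\<^bsub>G\<^esub> s) ` cores"
  proof -
    have "(\<lambda>i. core True e (i - j e)) ` {0..<period e} = core True e ` {0..<period e}" if e: "e < length ls" for e
    proof -
      have *: "core True e (i mod period e) = core True e i" for i
        using core_periodic[OF e, of True "i div period e" "i mod period e"] by simp
      have "core True e (i - j e) \<in> core True e ` {0..<period e}" for i
        using *[of "i - j e"] period_pos[OF e] by (metis atLeastLessThan_iff imageI pos_mod_bound pos_mod_sign)
      moreover have "core True e l \<in> (\<lambda>i. core True e (i - j e)) ` {0..<period e}" if "l \<in> {0..<period e}" for l
      proof -
        have "core True e ((l + j e) mod period e - j e) = core True e l"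
          using *[of "(l + j e) mod period e - j e"] *[of l] by (simp add: mod_diff_left_eq)
        then show ?thesis using period_pos[OF e] by (metis atLeastLessThan_iff rev_image_eqI pos_mod_bound pos_mod_sign)
      qed
      ultimately show ?thesis by blast
    qed
    then have "(\<Union>e<length ls. (\<lambda>i. core True e (i - j e)) ` {0..<period e}) = (\<Union>e<length ls. core True e ` {0..<period e})"
      by simp
    moreover have "cores = (\<Union>e<length ls. core True e ` {0..<period e})"
      unfolding cores_def by auto blast
    moreover have "(\<lambda>(e, i). ev v \<otimes>\<^bsub>G\<^esub> core True e (i - j e)) ` (SIGMA e:{..<length ls}. {0..<period e}) =
      (\<lambda>s. ev v \<otimes>\<^bsub>G\<^esub> s) ` (\<Union>e<length ls. (\<lambda>i. core True e (i - j e)) ` {0..<period e})"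
      by (force simp: image_iff)
    ultimately show ?thesis by simp
  qed
  finally show ?thesis .
qed

definition ball_gens :: "(two_vertices, nat, int) gog_gen word set set" where
  "ball_gens = (\<Union>d\<in>{0, 1}. \<Union>c\<in>{0, 1}. (\<lambda>s. \<gamma> True d \<otimes>\<^bsub>G\<^esub> s \<otimes>\<^bsub>G\<^esub> \<gamma> False c) ` cores)"

lemma cores_closed: "cores \<subseteq> carrier G"
  by (auto simp: cores_def)

lemma ev_nearby:
  assumes v: "v \<in> pts True"
  shows "ev ` nearby n strips v = (\<lambda>s. ev v \<otimes>\<^bsub>G\<^esub> s) ` ball_gens"
proof -
  have "ev ` shift c ` crossings n strips (shift d v) =
      (\<lambda>s. ev v \<otimes>\<^bsub>G\<^esub> s) ` (\<lambda>s. \<gamma> True d \<otimes>\<^bsub>G\<^esub> s \<otimes>\<^bsub>G\<^esub> \<gamma> False c) ` cores" for c d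
  proof -
    have "ev ` shift c ` crossings n strips (shift d v) =
        (\<lambda>g. g \<otimes>\<^bsub>G\<^esub> \<gamma> False c) ` ev ` crossings n strips (shift d v)"
      unfolding image_image
      using crossings_points[of n "shift d v" strips True] n v by (intro image_cong) (auto simp: ev_shift)
    also have "\<dots> = (\<lambda>s. ev v \<otimes>\<^bsub>G\<^esub> (\<gamma> True d \<otimes>\<^bsub>G\<^esub> s \<otimes>\<^bsub>G\<^esub> \<gamma> False c)) ` cores"
      using v cores_closed
      by (simp add: ev_crossings ev_shift image_image) (intro image_cong, auto simp: m_assoc subset_iff)
    finally show ?thesis by (simp add: image_image)
  qed
  then show ?thesis by (simp only: nearby_def ball_gens_def image_UN)
qed

lemma finite_ball_gens: "finite ball_gens"
proof -
  have "cores = (\<Union>e<length ls. core True e ` {0..<period e})"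
    unfolding cores_def by auto blast
  then show ?thesis by (simp add: ball_gens_def)
qed

section \<open>Counting strips and generating the group\<close>

lemma finite_strips: "finite (strips q)"
  by (rule finite_subset[of _ "SIGMA e:{..<length ls}. {0..<period e}"]) (auto simp: strips_def)

lemma card_strips:
  "int (card (strips q)) = (\<Sum>e<length ls. if out q e then period e else 0)"
proof -
  have "strips q = (SIGMA e:{e \<in> {..<length ls}. out q e}. {0..<period e})" by (auto simp: strips_def)
  then have "int (card (strips q)) = (\<Sum>e | e < length ls \<and> out q e. period e)"
    using period_pos by (auto simp: card_SigmaI intro!: sum.cong less_imp_le)
  also have "\<dots> = (\<Sum>e<length ls. if out q e then period e else 0)"
    by (simp add: sum.If_cases Int_def)
  finally show ?thesis .
qed

lemma card_strips_eq:
  "int (card (strips True)) = (\<Sum>(x, y)\<leftarrow>ls. if x = n * y then y else 0)"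
  "int (card (strips False)) = (\<Sum>(x, y)\<leftarrow>ls. if y = n * x then x else 0)"
proof -
  have "(if out True e then period e else 0) = (case ls ! e of (x, y) \<Rightarrow> if x = n * y then y else 0)"
    "(if out False e then period e else 0) = (case ls ! e of (x, y) \<Rightarrow> if y = n * x then x else 0)"
    if "e < length ls" for e
    using less_mult[OF lab_pos[OF that, of True]] less_mult[OF lab_pos[OF that, of False]]
    by (auto simp: out_def period_def lab_def split: prod.splits)
  then show "int (card (strips True)) = (\<Sum>(x, y)\<leftarrow>ls. if x = n * y then y else 0)"
    "int (card (strips False)) = (\<Sum>(x, y)\<leftarrow>ls. if y = n * x then x else 0)"
    by (simp_all add: card_strips sum_list_sum_nth atLeast0LessThan)
qed

lemma ball_gens_closed: "ball_gens \<subseteq> carrier G"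
  using cores_closed by (auto simp: ball_gens_def)

lemma \<theta>_cores: "e < length ls \<Longrightarrow> \<theta> True e \<in> cores"
  using core_0[of e True] period_pos[of e] unfolding cores_def by force

lemma ball_gensI: "s \<in> cores \<Longrightarrow> d \<in> {0, 1} \<Longrightarrow> c \<in> {0, 1} \<Longrightarrow> \<gamma> True d \<otimes>\<^bsub>G\<^esub> s \<otimes>\<^bsub>G\<^esub> \<gamma> False c \<in> ball_gens"
  unfolding ball_gens_def by blast

lemma one_ball_gens: "\<one>\<^bsub>G\<^esub> \<in> ball_gens"
  using ball_gensI[OF \<theta>_cores[OF zero_less_length], of 0 0] by simp

lemma generate_ball_gens: "generate G ball_gens = carrier G"
proof
  let ?H = "generate G ball_gens"
  interpret H: subgroup ?H G using ball_gens_closed by (rule generate_is_subgroup)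
  show "?H \<subseteq> carrier G" by (rule H.subset)
  \<comment> \<open>The stable letter of edge \<open>0\<close> is trivial, so a unit shift before or
    after crossing it is a generator of the respective vertex group.\<close>
  have "\<gamma> q 1 \<in> ball_gens" for q
    using ball_gensI[OF \<theta>_cores[OF zero_less_length], of 1 0] ball_gensI[OF \<theta>_cores[OF zero_less_length], of 0 1]
    by (cases q) simp_all
  then have 1: "\<gamma> q 1 \<in> ?H" for q by (rule generate.incl)
  have inv: "inv\<^bsub>G\<^esub> (\<gamma> q c) = \<gamma> q (- c)" for q c
    using \<gamma>_add[of q "- c" c] by (intro inv_equality) simp_all
  have \<gamma>_H: "\<gamma> q c \<in> ?H" for q c
  proof (induction c rule: int_induct[where k = 0])
    case (step1 i)
    then show ?case using H.m_closed[OF _ 1] by (metis \<gamma>_add)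
  next
    case (step2 i)
    then show ?case using H.m_closed[OF _ H.m_inv_closed[OF 1]] by (metis \<gamma>_add inv uminus_add_conv_diff add.commute)
  qed simp
  have \<theta>_H: "\<theta> q e \<in> ?H" if e: "e < length ls" for q e
  proof -
    have "\<theta> True e \<in> ?H"
      using ball_gensI[OF \<theta>_cores[OF e], of 0 0] e by (intro generate.incl) simp
    moreover have "inv\<^bsub>G\<^esub> (\<theta> True e) = \<theta> False e"
      using \<theta>_\<theta>[OF e, of False] e by (intro inv_equality) simp_all
    ultimately show ?thesis using H.m_inv_closed[of "\<theta> True e"] by (cases q) simp_all
  qed
  have "cls w \<in> ?H" if "w \<in> words gens" for w
    using that
  proof (induction w)
    case Nil
    then show ?case by (simp add: word_class_Nil flip: G_eq)
  next
    case (Cons s w)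
    obtain x b where s: "s = (x, b)" by force
    have x: "x \<in> gens" "w \<in> words gens" using Cons.hyps s by auto
    have "cls [(x, b)] \<in> ?H"
    proof (cases x)
      case (Vertex_elem u c)
      then have "x = Vertex_elem (vert True) c \<or> x = Vertex_elem (vert False) c"
        using two_vertices_exhaust[of u] by (auto simp: vert_def)
      then show ?thesis using cls_Vertex_elem \<gamma>_H by metis
    next
      case (Stable_letter e)
      then show ?thesis using x \<theta>_H[of e b] by (simp add: \<theta>_def)
    qed
    then show ?case using Cons.IH x s H.m_closed by (simp add: cls_Cons[of x w])
  qed
  then show "carrier G \<subseteq> ?H" by (auto simp: G_eq carrier_presented_group)
qed

end

section \<open>Comparison of two lists of labels\<close>

lemma admit_isomorphic_Cayley_graphs_two_vertex_group:
  assumes "two_vertex_labels n ls" and "two_vertex_labels n ls'"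
    and sum_out: "(\<Sum>(x, y)\<leftarrow>ls. if x = n * y then y else 0) = (\<Sum>(x, y)\<leftarrow>ls'. if x = n * y then y else 0)"
    and sum_in: "(\<Sum>(x, y)\<leftarrow>ls. if y = n * x then x else 0) = (\<Sum>(x, y)\<leftarrow>ls'. if y = n * x then x else 0)"
  shows "admit_isomorphic_Cayley_graphs (two_vertex_group ls) (two_vertex_group ls')"
proof -
  interpret L: two_vertex_labels n ls by fact
  interpret L': two_vertex_labels n ls' by fact
  have n: "n > 0" using L.n by simp
  have "card (L.strips q) = card (L'.strips q)" for q
    using L.card_strips_eq L'.card_strips_eq sum_out sum_in by (cases q) simp_all
  then have "\<exists>\<phi>. bij_betw \<phi> (L.strips q) (L'.strips q)" for q
    by (intro finite_same_card_bij L.finite_strips L'.finite_strips)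
  then obtain \<phi> where \<phi>: "\<And>q. bij_betw (\<phi> q) (L.strips q) (L'.strips q)" by metis
  define F where "F = map_prod (relabel \<phi>) (id :: int \<Rightarrow> int)"
  have F: "bij_betw F (L.pts q) (L'.pts q)" for q
    unfolding F_def by (rule bij_betw_relabel_points[OF n \<phi>])
  \<comment> \<open>The tree isomorphism read in the groups through \<open>ev\<close>, separately
    for the two kinds of points.\<close>
  define \<Phi> where "\<Phi> q = L'.ev \<circ> F \<circ> inv_into (L.pts q) L.ev" for q
  have \<Phi>: "bij_betw (\<Phi> q) (carrier L.G) (carrier L'.G)" for q
    unfolding \<Phi>_def comp_assoc
    by (rule bij_betw_trans[OF bij_betw_trans[OF bij_betw_inv_into[OF L.bij_betw_ev] F] L'.bij_betw_ev])
  have \<Phi>_ev: "\<Phi> q (L.ev v) = L'.ev (F v)" if "v \<in> L.pts q" for q v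
    using that bij_betw_imp_inj_on[OF L.bij_betw_ev] by (simp add: \<Phi>_def)
  have "\<Phi> False ` (\<lambda>s. g \<otimes>\<^bsub>L.G\<^esub> s) ` L.ball_gens = (\<lambda>s. \<Phi> True g \<otimes>\<^bsub>L'.G\<^esub> s) ` L'.ball_gens"
    if "g \<in> carrier L.G" for g
  proof -
    have "g \<in> L.ev ` L.pts True"
      unfolding bij_betw_imp_surj_on[OF L.bij_betw_ev] by (rule that)
    then obtain v where v: "g = L.ev v" "v \<in> L.pts True" by (rule imageE)
    have "F v \<in> L'.pts True" by (rule bij_betw_apply[OF F v(2)])
    have "\<Phi> False ` (\<lambda>s. g \<otimes>\<^bsub>L.G\<^esub> s) ` L.ball_gens = \<Phi> False ` L.ev ` nearby n L.strips v"
      using L.ev_nearby v by simp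
    also have "\<dots> = (\<lambda>u. L'.ev (F u)) ` nearby n L.strips v"
      unfolding image_image using nearby_points[OF n v(2)] by (intro image_cong) (auto simp: \<Phi>_ev)
    also have "\<dots> = L'.ev ` nearby n L'.strips (F v)"
      unfolding F_def nearby_relabel[OF n \<phi> v(2)] image_image ..
    also have "\<dots> = (\<lambda>s. \<Phi> True g \<otimes>\<^bsub>L'.G\<^esub> s) ` L'.ball_gens"
      using L'.ev_nearby[OF \<open>F v \<in> L'.pts True\<close>] v \<Phi>_ev by simp
    finally show ?thesis .
  qed
  then show ?thesis
    using \<Phi>
    by (intro admit_isomorphic_Cayley_graphsI[where S = L.ball_gens and S' = L'.ball_gens and \<Phi> = "\<Phi> True" and \<Psi> = "\<Phi> False"]
      L.finite_ball_gens L'.finite_ball_gens L.ball_gens_closed L'.ball_gens_closed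
      L.one_ball_gens L'.one_ball_gens L.generate_ball_gens L'.generate_ball_gens
      L.group_axioms L'.group_axioms)
qed

text \<open>The two sums come out, in the order of the groups, as \<open>k\<close> and
  \<open>k\<close>; \<open>k * 1\<close> and \<open>k\<close>; \<open>k * 1\<close> and
  \<open>(k - p) + p\<close>; \<open>k * 1\<close> and
  \<open>1 + n * ((k - 1) div n)\<close>.\<close>

lemma the_lattices_labels:
  assumes "1 < k" "1 < n" "G \<in> the_lattices k n"
  shows "\<exists>ls. G = two_vertex_group ls \<and> two_vertex_labels (int n) ls \<and>
    (\<Sum>(x, y)\<leftarrow>ls. if x = int n * y then y else 0) = int k \<and>
    (\<Sum>(x, y)\<leftarrow>ls. if y = int n * x then x else 0) = int k"
proof -
  have less: "a < int n * a" if "a > 0" for a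
    using that assms(2) by simp
  \<comment> \<open>These inequalities keep a label pair from being counted in both sums.\<close>
  have ne: "a \<noteq> int n * (int n * a)" "a \<noteq> int n * (a * int n)" "(1::int) \<noteq> int n * int n" if "a > 0" for a
  proof -
    have "(1::int) < int n * int n" using less[of 1] less[of "int n"] assms(2) by linarith
    then show "a \<noteq> int n * (int n * a)" "a \<noteq> int n * (a * int n)" "(1::int) \<noteq> int n * int n"
      using that by (auto simp: mult.commute)
  qed
  have I: ?thesis if "G = two_vertex_group ls" "two_vertex_labels (int n) ls"
    "(\<Sum>(x, y)\<leftarrow>ls. if x = int n * y then y else 0) = int k"
    "(\<Sum>(x, y)\<leftarrow>ls. if y = int n * x then x else 0) = int k" for ls
    using that by blast
  consider "G = G\<^sub>1 k n" | "G = G\<^sub>2 k n" | p where "G = G\<^sub>3 k n p" "1 < p" "p < k"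
    | "G = G\<^sub>4 k n" "[k = 1] (mod n)"
    using assms(3) by (auto simp: the_lattices_def split: if_splits)
  then show ?thesis
  proof cases
    case 1
    show ?thesis
      by (rule I[OF 1[unfolded G\<^sub>1_def]])
        (use assms ne[of "int k"] in \<open>auto simp: two_vertex_labels_def mult.commute\<close>)
  next
    case 2
    show ?thesis
      by (rule I[OF 2[unfolded G\<^sub>2_def]])
        (use assms ne[of "int k"] ne[of 1] in
          \<open>auto simp: two_vertex_labels_def mult.commute sum_list_replicate\<close>)
  next
    case 3
    show ?thesis
      by (rule I[OF 3(1)[unfolded G\<^sub>3_def]])
        (use assms 3 ne[of "int p"] ne[of 1] in
          \<open>auto simp: two_vertex_labels_def mult.commute sum_list_replicate\<close>)
  next
    case 4
    \<comment> \<open>The congruence makes the division exact, so that the edges labeled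
      \<open>(n, n^2)\<close> contribute \<open>k - 1\<close>.\<close>
    have "n dvd k - 1" using 4(2) assms(1) by (simp add: cong_altdef_nat)
    then have "(k - 1) div n * n = k - 1" by simp
    then have "int ((k - 1) div n) * int n = int k - 1"
      using assms(1) by (metis of_nat_diff of_nat_mult of_nat_1 less_imp_le)
    then show ?thesis
      by (intro I[OF 4(1)[unfolded G\<^sub>4_def]])
        (use assms ne[of "int n"] ne[of 1] in
          \<open>auto simp: two_vertex_labels_def mult.commute power2_eq_square sum_list_replicate\<close>)
  qed
qed

theorem corollary8p2:
  fixes k n :: nat
  assumes "1 < k" and "1 < n"
  shows "\<forall>G \<in> the_lattices k n. \<forall>H \<in> the_lattices k n. admit_isomorphic_Cayley_graphs G H"
proof (intro ballI)
  fix G H assume "G \<in> the_lattices k n" "H \<in> the_lattices k n"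
  from this[THEN the_lattices_labels[OF assms]] obtain ls ls' where
    "G = two_vertex_group ls" "two_vertex_labels (int n) ls"
    "(\<Sum>(x, y)\<leftarrow>ls. if x = int n * y then y else 0) = int k"
    "(\<Sum>(x, y)\<leftarrow>ls. if y = int n * x then x else 0) = int k"
    "H = two_vertex_group ls'" "two_vertex_labels (int n) ls'"
    "(\<Sum>(x, y)\<leftarrow>ls'. if x = int n * y then y else 0) = int k"
    "(\<Sum>(x, y)\<leftarrow>ls'. if y = int n * x then x else 0) = int k"
    by (elim exE conjE) rule
  then show "admit_isomorphic_Cayley_graphs G H"
    using admit_isomorphic_Cayley_graphs_two_vertex_group[of "int n" ls ls'] by simp
qed

end
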